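(* Let $q\neq 2$ be a prime power and let $D,N$ be integers with $N>2D\geq 6$. Let $\Gamma=(X,\mathcal R)$ be the bilinear forms graph $H_q(D,N-D)$, and let $E$ be the primitive idempotent of $\Gamma$ associated with its second largest eigenvalue $\theta_1$. Fix $x,y\in X$ with $k=\partial(x,y)$ satisfying $2\leq k\leq D-1$. Let $\{O_i\}_{i=1}^6$ be the $y$-partition of $\Gamma(x)$ and let $\{O'_i\}_{i=1}^6$ be the $x$-partition of $\Gamma(y)$. Then for $1\leq i\leq 6$, \[ E\widehat O_i - E\widehat O'_i = \lambda_i\,(E\hat x - E\hat y), \] where \[ \lambda_i = |O_i|\,\frac{\theta^*_1-\theta^*_k}{\theta^*_0-\theta^*_k}\quad (2\leq i\leq 5),\qquad \lambda_1 = |O_1|\,\frac{\theta^*_1-\theta^*_{k-1}}{\theta^*_0-\theta^*_k},\qquad \lambda_6 = |O_6|\,\frac{\theta^*_1-\theta^*_{k+1}}{\theta^*_0-\theta^*_k}. \]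
   Context: The bilinear forms graph $H_q(D,N-D)$: the vertex set $X$ is the set of all $D\times(N-D)$ matrices over $\mathrm{GF}(q)$, and two vertices are adjacent iff their difference has rank one. It is distance-regular with diameter $D$. $\partial$ is the path-length distance; $\Gamma_i(x)=\{z\in X:\partial(x,z)=i\}$ and $\Gamma(x)=\Gamma_1(x)$. $V=\mathbb R^X$ is the standard module with inner product $\langle u,v\rangle=u^tv$; $\hat x\in V$ is the vector with $x$-coordinate $1$ and all other coordinates $0$; for $\Omega\subseteq X$, $\widehat\Omega=\sum_{z\in\Omega}\hat z$. $A$ is the adjacency matrix, with eigenvalues $\theta_0>\theta_1>\cdots>\theta_D$, $\theta_i=(q^{N-i}+1-q^D-q^{N-D})/(q-1)$; $E$ is the matrix acting as the identity on the $\theta_1$-eigenspace of $A$ and as $0$ on the other eigenspaces. The scalars $\theta^*_i$ ($0\le i\le D$) are defined by $\theta^*_i=(q^{N-i}+1-q^D-q^{N-D})/(q-1)$ (these equal $|X|E_{u,v}$ for $\partial(u,v)=i$). The $y$-partition of $\Gamma(x)$ (for $\partial(x,y)=k$, $2\le k\le D-1$): for $z\in\Gamma(x)$ write $a(z)=|\Gamma(x)\cap\Gamma(z)\cap\Gamma_{k-1}(y)|$ and $b(z)=|\Gamma(x)\cap\Gamma(z)\cap\Gamma_{k+1}(y)|$. Set $O_1=\Gamma(x)\cap\Gamma_{k-1}(y)$, $O_6=\Gamma(x)\cap\Gamma_{k+1}(y)$, and let $O_2,O_3,O_4,O_5$ consist of those $z\in\Gamma(x)\cap\Gamma_k(y)$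 with $(a(z),b(z))$ equal to $(2q^{k-1},0)$, $(2q^{k-1}-1,0)$, $(q^{k-1},q^D-q^k)$, $(q^{k-1},q^{N-D}-q^k)$ respectively. It is known that these six sets are nonempty and partition $\Gamma(x)$. The $x$-partition $\{O'_i\}_{i=1}^6$ of $\Gamma(y)$ is defined in the same way with the roles of $x$ and $y$ interchanged. *)

theory Defs
  imports "HOL-Analysis.Analysis"
begin

section \<open>Distances in a graph given by its adjacency relation\<close>

text \<open>Path-length distance; it is meaningful only for vertices joined by some walk.\<close>

definition graph_dist :: "('v \<Rightarrow> 'v \<Rightarrow> bool) \<Rightarrow> 'v \<Rightarrow> 'v \<Rightarrow> nat" where
  "graph_dist adj x y = (LEAST n. (adj ^^ n) x y)"

definition sphere_at :: "('v \<Rightarrow> 'v \<Rightarrow> bool) \<Rightarrow> nat \<Rightarrow> 'v \<Rightarrow> 'v set" where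
  "sphere_at adj i x = {z. graph_dist adj x z = i}"

section \<open>Adjacency matrix and primitive idempotents\<close>

definition adjacency_matrix :: "('v::finite \<Rightarrow> 'v \<Rightarrow> bool) \<Rightarrow> real^'v^'v" where
  "adjacency_matrix adj = (\<chi> u v. if adj u v then 1 else 0)"

definition eigenspace :: "real^'v^'v \<Rightarrow> real \<Rightarrow> (real^'v) set" where
  "eigenspace A \<theta> = {v. A *v v = \<theta> *\<^sub>R v}"

definition eigenvalues :: "real^'v^'v \<Rightarrow> real set" where
  "eigenvalues A = {\<theta>. \<exists>v \<in> eigenspace A \<theta>. v \<noteq> 0}"

definition second_largest_eigenvalue :: "real^'v^'v \<Rightarrow> real" where
  "second_largest_eigenvalue A = Max (eigenvalues A - {Max (eigenvalues A)})"

text \<open>If \<open>A\<close> is symmetric, its eigenspaces span the whole space, so that this determines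
  \<open>E\<close> uniquely.\<close>

definition is_primitive_idempotent :: "real^'v^'v \<Rightarrow> real \<Rightarrow> real^'v^'v \<Rightarrow> bool" where
  "is_primitive_idempotent A \<theta> E \<longleftrightarrow>
     (\<forall>v \<in> eigenspace A \<theta>. E *v v = v) \<and>
     (\<forall>\<mu> \<in> eigenvalues A - {\<theta>}. \<forall>v \<in> eigenspace A \<mu>. E *v v = 0)"

definition hat :: "'v \<Rightarrow> real^'v" where
  "hat x = axis x 1"

definition hat_set :: "'v set \<Rightarrow> real^'v" where
  "hat_set \<Omega> = (\<Sum>z\<in>\<Omega>. hat z)"

section \<open>The bilinear forms graph\<close>

text \<open>The vertices of \<open>H_q(D, N - D)\<close> are the elements of the type \<open>'a^'n^'m\<close>, where \<open>'a\<close> is a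
  field with \<open>q\<close> elements, \<open>CARD('m) = D\<close> and \<open>CARD('n) = N - D\<close>.\<close>

definition bilinear_adj :: "'a::field^'n^'m \<Rightarrow> 'a^'n^'m \<Rightarrow> bool" where
  "bilinear_adj A B \<longleftrightarrow> rank (A - B) = 1"

definition theta_star :: "nat \<Rightarrow> nat \<Rightarrow> nat \<Rightarrow> nat \<Rightarrow> real" where
  "theta_star q D N i =
     (real q ^ (N - i) + 1 - real q ^ D - real q ^ (N - D)) / (real q - 1)"

text \<open>The \<open>y\<close>-partition of \<open>\<Gamma>(x)\<close>, with parts indexed by 1 to 6. Natural number subtraction is
  exact here, since \<open>2 \<le> k \<le> D - 1\<close> and \<open>2 D < N\<close> wherever the definition is used.\<close>

definition y_partition ::
  "('v \<Rightarrow> 'v \<Rightarrow> bool) \<Rightarrow> nat \<Rightarrow> nat \<Rightarrow> nat \<Rightarrow> 'v \<Rightarrow> 'v \<Rightarrow> nat \<Rightarrow> 'v set" where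
  "y_partition adj q D N x y i =
     (let k = graph_dist adj x y;
          S = sphere_at adj;
          a = (\<lambda>z. card (S 1 x \<inter> S 1 z \<inter> S (k - 1) y));
          b = (\<lambda>z. card (S 1 x \<inter> S 1 z \<inter> S (k + 1) y));
          P = (\<lambda>s t. {z \<in> S 1 x \<inter> S k y. a z = s \<and> b z = t})
      in if i = 1 then S 1 x \<inter> S (k - 1) y
         else if i = 2 then P (2 * q ^ (k - 1)) 0
         else if i = 3 then P (2 * q ^ (k - 1) - 1) 0
         else if i = 4 then P (q ^ (k - 1)) (q ^ D - q ^ k)
         else if i = 5 then P (q ^ (k - 1)) (q ^ (N - D) - q ^ k)
         else if i = 6 then S 1 x \<inter> S (k + 1) y
         else {})"

end

(* Put M = y - x. A neighbour of x has the form z = x + u v^T, and the rank of y - z = M - u v^T, as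
   well as the numbers a(z) and b(z), depends only on whether u lies in the column space of M,
   whether v lies in its row space and, if both hold, on the value of the bilinear pairing of the
   two spaces given by M. Hence every O_i is x + S for a union S of such types, and O'_i = y - S,
   since z |-> x + y - z is an isometry exchanging x and y.

   A function is killed by E as soon as its sum over every fibre of z |-> p z vanishes, for all row
   vectors p. Indeed, the adjacency matrix is up to scaling and a constant the sum over u of the
   commuting projections P_u that average a function over the shifts z |-> z + u v^T. On a joint
   eigenvector its eigenvalue is determined by the size of the subspace {u. P_u g = g}; the second
   largest eigenvalue belongs to the hyperplanes {u. p u = 0}, that is, to functions of p z.

   For the function O_i^ - O'_i^ - lambda (x^ - y^) these sums are differences of the numbers
   n(c) = |{s in S. p s = c}|: n(c) = n(p M - c) for c distinct from 0 and p M, while n(0) - n(p M)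
   is the same for all p with p M nonzero, and its value follows by double counting over p. *)

theory Submission
  imports Defs
begin

section \<open>Linear algebra over a finite field\<close>

text \<open>Ranks are measured by the size of the left kernel {p. p M = 0}, since |left kernel| *
  q^rank = q^D. A step in the graph then multiplies this size by q, divides it by q or leaves it
  alone, and the same row vectors p index the fibres used later.

  What is proved about a(z) and b(z) is that they are constant on each of the types 2 to 5. For 2 <=
  i <= 5 the part O_i is thus obtained as some union of such types. The coefficient depends on the
  part only through its size and through the common size of the left kernels of M - s.

  The obstacle in the count is the fibre over 0: a matrix s = u v^T with p s = c has the normal form
  p u = 1, v = c only for nonzero c. So n(0) is reached as the total minus all other fibres. Double
  counting gives lambda (q^D - q^(D-k)) = |S| (q^(D-1) - q^(D-j)), where j is the distance from y to
  the vertices x + s. Up to the common factor q^(N-D)/(q-1), these differences of powers are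
  differences of values of \<open>theta_star\<close>.\<close>

abbreviation dotp :: "'a::semiring_1^'n \<Rightarrow> 'a^'n \<Rightarrow> 'a" (infixl "\<cdot>" 70) where
  "dotp \<equiv> scalar_product"

lemma dotp_linear [simp]:
  fixes p r u w :: "'a::field^'n"
  shows "(p + r) \<cdot> u = p \<cdot> u + r \<cdot> u" "p \<cdot> (u + w) = p \<cdot> u + p \<cdot> w"
    "(p - r) \<cdot> u = p \<cdot> u - r \<cdot> u" "p \<cdot> (u - w) = p \<cdot> u - p \<cdot> w"
    "(c *s p) \<cdot> u = c * (p \<cdot> u)" "p \<cdot> (c *s u) = c * (p \<cdot> u)"
    "0 \<cdot> u = 0" "p \<cdot> 0 = 0" "(- p) \<cdot> u = - (p \<cdot> u)" "p \<cdot> (- u) = - (p \<cdot> u)"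
  by (simp_all add: scalar_product_def algebra_simps sum.distrib sum_subtractf sum_distrib_left sum_negf)

lemma dotp_commute: "p \<cdot> u = u \<cdot> (p :: 'a::field^'n)"
  by (simp add: scalar_product_def mult.commute)

lemma dotp_axis [simp]: "axis i 1 \<cdot> (u :: 'a::field^'n) = u $ i"
  by (simp add: scalar_product_def axis_def if_distrib if_distribR cong: if_cong)

lemma ex_dotp_eq_1:
  fixes u :: "'a::field^'n"
  assumes "u \<noteq> 0"
  obtains p where "p \<cdot> u = 1"
proof -
  obtain i where i: "u $ i \<noteq> 0"
    using assms by (auto simp: vec_eq_iff)
  have "(inverse (u $ i) *s axis i 1) \<cdot> u = 1"
    using i by simp
  then show thesis by (rule that)
qed

definition outer :: "'a::field^'m \<Rightarrow> 'a^'n \<Rightarrow> 'a^'n^'m" where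
  "outer u v = (\<chi> i j. u $ i * v $ j)"

lemma outer_nth [simp]: "outer u v $ i $ j = u $ i * v $ j"
  by (simp add: outer_def)

lemma outer_linear:
  "outer (u + u') v = outer u v + outer u' v" "outer u (v + v') = outer u v + outer u v'"
  "outer (u - u') v = outer u v - outer u' v" "outer u (v - v') = outer u v - outer u v'"
  "outer (- u) v = - outer u v" "outer u (- v) = - outer u v"
  "outer 0 v = 0" "outer u 0 = 0"
  "outer u (c *s v) = outer (c *s u) v"
  by (simp_all add: vec_eq_iff algebra_simps)

lemma outer_eq_0_iff [simp]: "outer u v = 0 \<longleftrightarrow> u = 0 \<or> v = 0"
  by (auto simp: vec_eq_iff)

lemma vector_mult_outer [simp]: "p v* outer u v = (p \<cdot> u) *s v"
  by (simp add: vec_eq_iff vector_matrix_mult_def scalar_product_def sum_distrib_right mult.assoc)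

lemma vector_scaled_matrix_mult [simp]:
  fixes M :: "'a::field^'n^'m"
  shows "(c *s p) v* M = c *s (p v* M)" "(- p) v* M = - (p v* M)" "p v* (- M) = - (p v* M)"
  by (simp_all add: vec_eq_iff vector_matrix_mult_def sum_distrib_left mult.assoc sum_negf)

text \<open>Rank is the dimension of the row space. If this is a line, \<open>v\<close> is a
  generator and \<open>u\<close> lists the multiples of \<open>v\<close> that occur as rows.\<close>

lemma rank_eq_1_iff:
  fixes A :: "'a::field^'n^'m"
  shows "rank A = 1 \<longleftrightarrow> (\<exists>u v. u \<noteq> 0 \<and> v \<noteq> 0 \<and> A = outer u v)"
proof
  assume "rank A = 1"
  then have d: "vec.dim (rows A) = 1"
    by (simp add: row_rank_def_gen)
  obtain B where B: "B \<subseteq> rows A" "vec.independent B" "rows A \<subseteq> vec.span B" "card B = vec.dim (rows A)"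
    using vec.basis_exists by metis
  then obtain v where v: "B = {v}"
    using d by (metis card_1_singletonE)
  have v0: "v \<noteq> 0"
    using B(2) vec.dependent_zero v by blast
  have "A $ i \<in> vec.span {v}" for i
    using B(3) v by (auto simp: rows_def row_def vec_lambda_eta)
  then have "\<exists>c. A $ i = c *s v" for i
    by (auto simp: vec.span_singleton)
  then obtain c where c: "\<And>i. A $ i = c i *s v"
    by metis
  then have "A = outer (\<chi> i. c i) v"
    by (simp add: vec_eq_iff)
  moreover have "(\<chi> i. c i) \<noteq> 0"
  proof
    assume z: "(\<chi> i. c i) = 0"
    then have "\<And>i. c i = 0"
      by (simp add: vec_eq_iff)
    then have "A = 0"
      by (simp add: vec_eq_iff c)
    then have "rows A \<subseteq> {0}"
      by (auto simp: rows_def row_def vec_eq_iff)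
    then show False
      using B(1) v v0 by auto
  qed
  ultimately show "\<exists>u v. u \<noteq> 0 \<and> v \<noteq> 0 \<and> A = outer u v"
    using v0 by blast
next
  assume "\<exists>u v. u \<noteq> 0 \<and> v \<noteq> 0 \<and> A = outer u v"
  then obtain u v where uv: "u \<noteq> 0" "v \<noteq> 0" "A = outer u v"
    by blast
  have row: "row i A = u $ i *s v" for i
    using uv by (simp add: row_def vec_eq_iff)
  obtain i where i: "u $ i \<noteq> 0"
    using uv by (auto simp: vec_eq_iff)
  have "v = inverse (u $ i) *s row i A"
    using i by (simp add: row)
  also have "\<dots> \<in> vec.span (rows A)"
    by (intro vec.span_scale vec.span_base) (auto simp: rows_def)
  finally have "{v} \<subseteq> vec.span (rows A)"
    by simp
  moreover have "rows A \<subseteq> vec.span {v}"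
    by (auto simp: rows_def row vec.span_singleton)
  ultimately have "vec.span (rows A) = vec.span {v}"
    by (metis vec.span_eq vec.span_mono vec.span_span subset_antisym)
  then have "vec.dim (rows A) = vec.dim {v}"
    by (metis vec.dim_span)
  also have "\<dots> = 1"
    using uv(2) by (subst vec.dim_eq_card_independent) auto
  finally show "rank A = 1"
    by (simp add: row_rank_def_gen)
qed

lemma proportional_if_minors_0:
  fixes u w :: "'a::field^'n"
  assumes "u \<noteq> 0" "\<And>i k. u $ i * w $ k = w $ i * u $ k"
  obtains c where "w = c *s u"
proof -
  obtain i where i: "u $ i \<noteq> 0"
    using assms(1) by (auto simp: vec_eq_iff)
  have "w = (w $ i / u $ i) *s u"
    using assms(2)[of i] i by (simp add: vec_eq_iff field_simps)
  then show thesis by (rule that)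
qed

text \<open>The \<open>2 \<times> 2\<close> minors of \<open>outer u v - outer u' v'\<close> are products of minors of the pairs
  \<open>u, u'\<close> and \<open>v, v'\<close>.\<close>

lemma proportional_if_rank_diff_1:
  fixes u u' :: "'a::field^'m" and v v' :: "'a^'n"
  assumes "u \<noteq> 0" "v \<noteq> 0" and r: "rank (outer u v - outer u' v') = 1"
  shows "(\<exists>c. u' = c *s u) \<or> (\<exists>c. v' = c *s v)"
proof -
  obtain a b where ab: "outer u v - outer u' v' = outer a b"
    using r rank_eq_1_iff by metis
  have e: "u $ i * v $ j - u' $ i * v' $ j = a $ i * b $ j" for i j
    using arg_cong[OF ab, of "\<lambda>A. A $ i $ j"] by simp
  have minors: "(u $ i * u' $ k - u' $ i * u $ k) * (v $ j * v' $ l - v' $ j * v $ l) = 0" for i k j l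
  proof -
    have "(u $ i * u' $ k - u' $ i * u $ k) * (v $ j * v' $ l - v' $ j * v $ l)
      = - ((u $ i * v $ j - u' $ i * v' $ j) * (u $ k * v $ l - u' $ k * v' $ l)
        - (u $ i * v $ l - u' $ i * v' $ l) * (u $ k * v $ j - u' $ k * v' $ j))"
      by (simp add: algebra_simps)
    also have "\<dots> = 0"
      unfolding e by simp
    finally show ?thesis .
  qed
  show ?thesis
  proof (cases "\<forall>i k. u $ i * u' $ k = u' $ i * u $ k")
    case True
    then show ?thesis
      using proportional_if_minors_0[OF assms(1), of u'] by metis
  next
    case False
    then have "\<forall>j l. v $ j * v' $ l = v' $ j * v $ l"
      using minors by (metis mult_eq_0_iff right_minus_eq)
    then show ?thesis
      using proportional_if_minors_0[OF assms(2), of v'] by metis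
  qed
qed

text \<open>A functional \<open>p\<close> with value 1 at \<open>u\<close> compares the second
  factors, and then the first factors follow by cancelling. So a scalar is the only freedom in
  writing a rank one matrix as an outer product.\<close>

lemma outer_eq_iff:
  assumes "outer u v = outer u' v'" "u \<noteq> 0" "v \<noteq> 0"
  obtains c where "c \<noteq> 0" "u = c *s u'" "v' = c *s v"
proof -
  obtain p where p: "p \<cdot> u = 1"
    using ex_dotp_eq_1 assms(2) by metis
  have e: "v = (p \<cdot> u') *s v'"
    using arg_cong[OF assms(1), of "(v*) p"] p by simp
  define d where "d = p \<cdot> u'"
  have d0: "d \<noteq> 0"
    using e assms(3) d_def by auto
  have v': "v' = inverse d *s v"
    using e d0 by (simp add: d_def)
  have "outer u v = outer (inverse d *s u') v"
    using assms(1) v' by (simp add: outer_linear)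
  then have "outer (u - inverse d *s u') v = 0"
    by (simp add: outer_linear)
  then have "u = inverse d *s u'"
    using assms(3) by simp
  then show thesis
    using that[of "inverse d"] d0 v' by simp
qed

text \<open>Adding a multiple of \<open>g0\<close> carries one fibre of \<open>f\<close> onto any
  other, so all \<open>CARD('a)\<close> fibres have equal size. Linearity is asked only on
  \<open>G\<close>, because \<open>pairing M u\<close> is junk off the row space. The product form
  avoids division of naturals.\<close>

lemma card_fibre_linear:
  fixes G :: "('a::{field,finite}^'m) set" and f :: "'a^'m \<Rightarrow> 'a"
  assumes G: "vec.subspace G"
    and add: "\<And>g h. g \<in> G \<Longrightarrow> h \<in> G \<Longrightarrow> f (g + h) = f g + f h"
    and scale: "\<And>c g. g \<in> G \<Longrightarrow> f (c *s g) = c * f g"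
    and g0: "g0 \<in> G" "f g0 \<noteq> 0"
  shows "CARD('a) * card {g \<in> G. f g = b} = card G"
proof -
  have fibre: "card {g \<in> G. f g = c} = card {g \<in> G. f g = b}" for c
  proof -
    define h where "h = ((b - c) / f g0) *s g0"
    have h: "h \<in> G" "f h = b - c"
      using G g0 by (auto simp: h_def vec.subspace_scale scale)
    have h': "- h \<in> G" "f (- h) = c - b"
      using G h vec.subspace_neg scale[OF h(1), of "-1"] by (auto simp: vec_eq_iff)
    show ?thesis
    proof (rule bij_betw_same_card)
      show "bij_betw (\<lambda>g. g + h) {g \<in> G. f g = c} {g \<in> G. f g = b}"
        by (rule bij_betw_byWitness[where f' = "\<lambda>g. g + - h"])
          (use h h' add vec.subspace_add[OF G] in \<open>auto simp del: add_uminus_conv_diff\<close>)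
    qed
  qed
  have "card G = (\<Sum>c\<in>UNIV. card {g \<in> G. f g = c})"
    using sum.group[of G UNIV f "\<lambda>_. 1 :: nat"] by simp
  also have "\<dots> = (\<Sum>c\<in>(UNIV :: 'a set). card {g \<in> G. f g = b})"
    by (rule sum.cong[OF refl fibre])
  finally show ?thesis
    by simp
qed

lemma subspace_UNIV_vec: "vec.subspace (UNIV :: ('a::field^'m) set)"
  by (simp add: vec.subspace_def)

lemma card_dotp_fibre:
  fixes u :: "'a::{field,finite}^'m"
  assumes "u \<noteq> 0"
  shows "CARD('a) * card {p. p \<cdot> u = b} = CARD('a) ^ CARD('m)"
    and "CARD('a) * card {p. u \<cdot> p = b} = CARD('a) ^ CARD('m)"
proof -
  obtain p where "p \<cdot> u = 1"
    using ex_dotp_eq_1 assms by metis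
  then show "CARD('a) * card {p. p \<cdot> u = b} = CARD('a) ^ CARD('m)"
    using card_fibre_linear[OF subspace_UNIV_vec, of "\<lambda>p. p \<cdot> u" p b] by simp
  then show "CARD('a) * card {p. u \<cdot> p = b} = CARD('a) ^ CARD('m)"
    by (simp add: dotp_commute)
qed

lemma ex_annihilator:
  fixes T :: "('a::field^'m) set"
  assumes T: "vec.subspace T" "T \<noteq> UNIV"
  obtains p where "p \<noteq> 0" "T \<subseteq> {u. p \<cdot> u = 0}"
proof -
  obtain a where a: "a \<notin> T"
    using T(2) by blast
  obtain B where B: "B \<subseteq> T" "vec.independent B" "T \<subseteq> vec.span B"
    using vec.basis_exists by metis
  have "vec.span B \<subseteq> T"
    using B(1) T(1) by (simp add: vec.span_minimal)
  then have "a \<notin> vec.span B"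
    using a by blast
  then have ind: "vec.independent (insert a B)"
    using B(2) by (simp add: vec.independent_insert)
  obtain g :: "'a^'m \<Rightarrow> 'a^'m" where
    g: "Vector_Spaces.linear (*s) (*s) g" "\<forall>x\<in>insert a B. g x = (if x = a then axis undefined 1 else 0)"
    using vec.linear_independent_extend[OF ind, of "\<lambda>x. if x = a then axis undefined 1 else 0"] by blast
  \<comment> \<open>The functional with value 1 at \<open>a\<close> and 0 on \<open>B\<close> is one
    coordinate of an endomorphism; \<open>undefined\<close> is merely some fixed index.\<close>
  define p where "p = matrix g $ undefined"
  have p: "p \<cdot> u = g u $ undefined" for u
  proof -
    have "g u = matrix g *v u"
      by (simp add: matrix_works g(1))
    then show ?thesis
      by (simp add: p_def matrix_vector_mult_def scalar_product_def)
  qed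
  have "p \<cdot> a = 1"
    using p g(2) by simp
  then have "p \<noteq> 0"
    by auto
  moreover have "p \<cdot> u = 0" if "u \<in> T" for u
  proof -
    have "u \<in> vec.span B"
      using that B by blast
    then show ?thesis
    proof (induction rule: vec.span_induct_alt)
      case base
      then show ?case by simp
    next
      case (step c x y)
      then have "x \<noteq> a"
        using B(1) a by blast
      then show ?case
        using step g(2) by (simp add: p)
    qed
  qed
  ultimately show thesis
    using that by blast
qed

section \<open>Rank one perturbations of a matrix\<close>

definition left_kernel :: "'a::field^'n^'m \<Rightarrow> ('a^'m) set" where
  "left_kernel M = {p. p v* M = 0}"

text \<open>Encoded as the annihilator of the left kernel: a vector outside it comes with a left
  kernel vector that does not annihilate it, and \<open>pairing\<close> is well defined on it at
  once. The columns of \<open>M\<close> enter only in \<open>dotp_vector_mult_eq_0\<close>.\<close>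

definition col_space :: "'a::field^'n^'m \<Rightarrow> ('a^'m) set" where
  "col_space M = {u. \<forall>p\<in>left_kernel M. p \<cdot> u = 0}"

definition row_space :: "'a::field^'n^'m \<Rightarrow> ('a^'n) set" where
  "row_space M = range (\<lambda>r. r v* M)"

text \<open>If \<open>u\<close> is in the column space and \<open>v\<close> in the row space, \<open>r \<cdot> u\<close> does not depend on the choice
  of \<open>r\<close>; for \<open>v\<close> outside the row space the value is junk.\<close>

definition pairing :: "'a::field^'n^'m \<Rightarrow> 'a^'m \<Rightarrow> 'a^'n \<Rightarrow> 'a" where
  "pairing M u v = (SOME r. r v* M = v) \<cdot> u"

text \<open>The type of the neighbour \<open>x + outer u v\<close> of \<open>x\<close>, for \<open>M = y - x\<close>. Subtracting \<open>outer u v\<close> lowers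
  the rank of \<open>M\<close> for type 1, raises it for type 6, and preserves it for types 2 to 5.\<close>

definition outer_type :: "'a::field^'n^'m \<Rightarrow> 'a^'m \<Rightarrow> 'a^'n \<Rightarrow> nat" where
  "outer_type M u v =
     (if u \<in> col_space M then
        if v \<in> row_space M then
          if pairing M u v = 1 then 1 else if pairing M u v = 0 then 2 else 3
        else 4
      else if v \<in> row_space M then 5 else 6)"

lemma outer_type_mem [simp]: "outer_type M u v \<in> {1..6}"
  by (simp add: outer_type_def)

lemma subspace_left_kernel: "vec.subspace (left_kernel M)"
  by (auto simp: vec.subspace_def left_kernel_def vector_matrix_left_distrib)

lemma subspace_col_space: "vec.subspace (col_space M)"
  by (auto simp: vec.subspace_def col_space_def)

lemma subspace_row_space: "vec.subspace (row_space M)"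
proof -
  have "0 \<in> row_space M"
    unfolding row_space_def by (rule range_eqI[of _ _ 0]) simp
  moreover have "v + w \<in> row_space M" if "v \<in> row_space M" "w \<in> row_space M" for v w
    using that by (auto simp: row_space_def simp flip: vector_matrix_left_distrib)
  moreover have "c *s v \<in> row_space M" if "v \<in> row_space M" for c v
    using that by (auto simp: row_space_def simp flip: vector_scaled_matrix_mult)
  ultimately show ?thesis
    by (simp add: vec.subspace_def)
qed

lemma in_subspace_scale_iff:
  assumes "vec.subspace S" "c \<noteq> 0"
  shows "c *s v \<in> S \<longleftrightarrow> v \<in> S"
proof
  assume "c *s v \<in> S"
  then have "inverse c *s (c *s v) \<in> S"
    using assms(1) vec.subspace_scale by blast
  then show "v \<in> S"
    using assms(2) by simp
qed (use assms vec.subspace_scale in blast)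

lemma pairing_vector_mult:
  assumes "u \<in> col_space M"
  shows "pairing M u (r v* M) = r \<cdot> u"
proof -
  define r' where "r' = (SOME r'. r' v* M = r v* M)"
  have "r' v* M = r v* M"
    unfolding r'_def by (rule someI[of _ r]) simp
  then have "r' - r \<in> left_kernel M"
    by (simp add: left_kernel_def vector_matrix_mult_diff_distrib)
  then have "(r' - r) \<cdot> u = 0"
    using assms unfolding col_space_def by blast
  then show ?thesis
    by (simp add: pairing_def r'_def)
qed

lemma pairing_linear:
  assumes "u \<in> col_space M" "v \<in> row_space M"
  shows "pairing M (c *s u) v = c * pairing M u v"
    and "pairing M u (c *s v) = c * pairing M u v"
    and "u' \<in> col_space M \<Longrightarrow> pairing M (u + u') v = pairing M u v + pairing M u' v"
    and "w \<in> row_space M \<Longrightarrow> pairing M u (v + w) = pairing M u v + pairing M u w"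
proof -
  obtain r where r: "v = r v* M"
    using assms(2) by (auto simp: row_space_def)
  have sub: "c *s u \<in> col_space M" "u' \<in> col_space M \<Longrightarrow> u + u' \<in> col_space M"
    using assms(1) subspace_col_space vec.subspace_scale vec.subspace_add by blast+
  show "pairing M (c *s u) v = c * pairing M u v"
    using pairing_vector_mult[OF assms(1), of r] pairing_vector_mult[OF sub(1), of r] r by simp
  show "pairing M u (c *s v) = c * pairing M u v"
    using pairing_vector_mult[OF assms(1), of r] pairing_vector_mult[OF assms(1), of "c *s r"] r by simp
  show "pairing M (u + u') v = pairing M u v + pairing M u' v" if "u' \<in> col_space M"
    using pairing_vector_mult[OF assms(1), of r] pairing_vector_mult[OF that, of r]
      pairing_vector_mult[OF sub(2)[OF that], of r] r by simp
  show "pairing M u (v + w) = pairing M u v + pairing M u w" if "w \<in> row_space M"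
  proof -
    obtain r' where r': "w = r' v* M"
      using \<open>w \<in> row_space M\<close> by (auto simp: row_space_def)
    show ?thesis
      using pairing_vector_mult[OF assms(1), of r] pairing_vector_mult[OF assms(1), of r']
        pairing_vector_mult[OF assms(1), of "r + r'"] r r' by (simp add: vector_matrix_left_distrib)
  qed
qed

text \<open>Both pairs have the same outer product, and by \<open>outer_eq_iff\<close> there is no
  other ambiguity. So the type belongs to the matrix \<open>outer u v\<close>, not to the chosen
  factors.\<close>

lemma outer_type_scale:
  assumes "c \<noteq> 0"
  shows "outer_type M (c *s u) v = outer_type M u (c *s v)"
proof -
  have "c *s u \<in> col_space M \<longleftrightarrow> u \<in> col_space M" "c *s v \<in> row_space M \<longleftrightarrow> v \<in> row_space M"
    using assms subspace_col_space subspace_row_space in_subspace_scale_iff by blast+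
  then show ?thesis
    by (simp add: outer_type_def pairing_linear)
qed

text \<open>The columns of \<open>M\<close> lie in \<open>col_space M\<close>, and applying
  \<open>p\<close> to column \<open>j\<close> gives entry \<open>j\<close> of \<open>p v* M\<close>.
  This is the double annihilator property, obtained without dimensions.\<close>

lemma dotp_vector_mult_eq_0:
  assumes "\<And>u. u \<in> col_space M \<Longrightarrow> p \<cdot> u = 0"
  shows "p \<in> left_kernel M"
proof -
  have col: "p \<cdot> column j M = (p v* M) $ j" for p j
    by (simp add: scalar_product_def column_def vector_matrix_mult_def)
  then have "column j M \<in> col_space M" for j
    by (auto simp: col_space_def left_kernel_def)
  then have "(p v* M) $ j = 0" for j
    using assms col by metis
  then show ?thesis
    by (simp add: left_kernel_def vec_eq_iff)
qed

lemma ex_col_space_dotp_eq_1: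
  assumes "p \<notin> left_kernel M"
  obtains u where "u \<in> col_space M" "p \<cdot> u = 1"
proof -
  obtain u where u: "u \<in> col_space M" "p \<cdot> u \<noteq> 0"
    using dotp_vector_mult_eq_0 assms by blast
  show thesis
    by (rule that[of "inverse (p \<cdot> u) *s u"]) (use u subspace_col_space vec.subspace_scale in auto)
qed

text \<open>A vector \<open>p\<close> is in the new left kernel iff
  \<open>p v* M = (p \<cdot> u) *s v\<close>. Those with \<open>p \<cdot> u = 0\<close> form
  \<open>K u\<close>. Any other can be scaled to some \<open>r\<close> as in the first case, and
  then the new kernel is the direct sum of \<open>K u\<close> and the line through
  \<open>r\<close>.\<close>

lemma card_left_kernel_minus_outer:
  fixes M :: "'a::{field,finite}^'n^'m"
  defines "K \<equiv> \<lambda>u. {l \<in> left_kernel M. l \<cdot> u = 0}"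
  shows "r v* M = v \<Longrightarrow> r \<cdot> u = 1 \<Longrightarrow> card (left_kernel (M - outer u v)) = CARD('a) * card (K u)"
    and "\<nexists>r. r v* M = v \<and> r \<cdot> u = 1 \<Longrightarrow> left_kernel (M - outer u v) = K u"
proof -
  assume r: "r v* M = v" "r \<cdot> u = 1"
  have "bij_betw (\<lambda>(c, l). l + c *s r) (UNIV \<times> K u) (left_kernel (M - outer u v))"
    by (rule bij_betw_byWitness[where f' = "\<lambda>p. (p \<cdot> u, p - (p \<cdot> u) *s r)"])
      (use r in \<open>auto simp: K_def left_kernel_def vector_matrix_left_distrib
        vector_matrix_mult_diff_distrib vector_matrix_mult_diff_rdistrib\<close>)
  then have "card ((UNIV :: 'a set) \<times> K u) = card (left_kernel (M - outer u v))"
    by (rule bij_betw_same_card)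
  then show "card (left_kernel (M - outer u v)) = CARD('a) * card (K u)"
    by (simp add: card_cartesian_product)
next
  assume no: "\<nexists>r. r v* M = v \<and> r \<cdot> u = 1"
  have "p \<cdot> u = 0" if "p v* M = (p \<cdot> u) *s v" for p
  proof (rule ccontr)
    assume "p \<cdot> u \<noteq> 0"
    then have "(inverse (p \<cdot> u) *s p) v* M = v \<and> (inverse (p \<cdot> u) *s p) \<cdot> u = 1"
      using that by simp
    then show False
      using no by blast
  qed
  then show "left_kernel (M - outer u v) = K u"
    by (auto simp: K_def left_kernel_def vector_matrix_mult_diff_rdistrib)
qed

text \<open>Two effects compete: \<open>K u\<close> is smaller than the left kernel by a factor q
  iff \<open>u\<close> is outside the column space, and a factor q is gained iff a suitable
  \<open>r\<close> exists. Types 2, 3 and 4 show neither effect; for type 5 both occur and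
  cancel.\<close>

lemma card_left_kernel_minus_outer_type:
  fixes M :: "'a::{field,finite}^'n^'m"
  shows "outer_type M u v = 1 \<Longrightarrow> card (left_kernel (M - outer u v)) = CARD('a) * card (left_kernel M)"
    and "outer_type M u v = 6 \<Longrightarrow> CARD('a) * card (left_kernel (M - outer u v)) = card (left_kernel M)"
    and "outer_type M u v \<in> {2..5} \<Longrightarrow> card (left_kernel (M - outer u v)) = card (left_kernel M)"
proof -
  have in_col: "{l \<in> left_kernel M. l \<cdot> u = 0} = left_kernel M" if "u \<in> col_space M"
    using that by (auto simp: col_space_def)
  have notin_col: "CARD('a) * card {l \<in> left_kernel M. l \<cdot> u = 0} = card (left_kernel M)"
    and ex_l: "\<exists>l\<in>left_kernel M. l \<cdot> u = 1" if u: "u \<notin> col_space M"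
  proof -
    obtain l where l: "l \<in> left_kernel M" "l \<cdot> u \<noteq> 0"
      using u by (auto simp: col_space_def)
    then show "CARD('a) * card {l \<in> left_kernel M. l \<cdot> u = 0} = card (left_kernel M)"
      by (intro card_fibre_linear[where ?g0.0 = l] subspace_left_kernel) auto
    have "inverse (l \<cdot> u) *s l \<in> left_kernel M"
      using l subspace_left_kernel vec.subspace_scale by blast
    then show "\<exists>l\<in>left_kernel M. l \<cdot> u = 1"
      by (rule rev_bexI) (simp add: l)
  qed
  show "card (left_kernel (M - outer u v)) = CARD('a) * card (left_kernel M)" if "outer_type M u v = 1"
  proof -
    have u: "u \<in> col_space M" and "v \<in> row_space M" and p: "pairing M u v = 1"
      using that by (auto simp: outer_type_def split: if_splits)
    then obtain r where r: "r v* M = v"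
      by (auto simp: row_space_def)
    then have "r \<cdot> u = 1"
      using p pairing_vector_mult[OF u] by metis
    then show ?thesis
      using card_left_kernel_minus_outer(1)[OF r] in_col[OF u] by simp
  qed
  show "CARD('a) * card (left_kernel (M - outer u v)) = card (left_kernel M)" if "outer_type M u v = 6"
  proof -
    have u: "u \<notin> col_space M" and v: "v \<notin> row_space M"
      using that by (auto simp: outer_type_def split: if_splits)
    then have "\<nexists>r. r v* M = v \<and> r \<cdot> u = 1"
      by (auto simp: row_space_def)
    then show ?thesis
      using card_left_kernel_minus_outer(2)[of M v u] notin_col[OF u] by simp
  qed
  show "card (left_kernel (M - outer u v)) = card (left_kernel M)" if t: "outer_type M u v \<in> {2..5}"
  proof (cases "u \<in> col_space M")
    case u: True
    have "\<nexists>r. r v* M = v \<and> r \<cdot> u = 1"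
    proof
      assume "\<exists>r. r v* M = v \<and> r \<cdot> u = 1"
      then obtain r where r: "r v* M = v" "r \<cdot> u = 1"
        by blast
      then have "v \<in> row_space M" "pairing M u v = 1"
        using pairing_vector_mult[OF u, of r] by (auto simp: row_space_def)
      then show False
        using t u by (simp add: outer_type_def)
    qed
    then show ?thesis
      using card_left_kernel_minus_outer(2)[of M v u] in_col[OF u] by simp
  next
    case u: False
    then have "v \<in> row_space M"
      using t by (auto simp: outer_type_def split: if_splits)
    then obtain r where r: "r v* M = v"
      by (auto simp: row_space_def)
    obtain l where l: "l \<in> left_kernel M" "l \<cdot> u = 1"
      using ex_l[OF u] by blast
    \<comment> \<open>Adding a left kernel vector does not change \<open>r v* M\<close>, so the
      value at \<open>u\<close> can be corrected to 1.\<close>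
    define r' where "r' = r + (1 - r \<cdot> u) *s l"
    have "r' v* M = v" "r' \<cdot> u = 1"
      using r l by (auto simp: r'_def left_kernel_def vector_matrix_left_distrib vector_matrix_mult_diff_distrib)
    then show ?thesis
      using card_left_kernel_minus_outer(1)[of r' M v u] notin_col[OF u] by simp
  qed
qed

lemma card_left_kernel_pos: "0 < card (left_kernel (M :: 'a::{field,finite}^'n^'m))"
  using vec.subspace_0[OF subspace_left_kernel[of M]] by (auto simp: card_gt_0_iff)

lemma left_kernel_uminus [simp]: "left_kernel (- M) = left_kernel M"
  by (simp add: left_kernel_def)

lemma left_kernel_diff_commute: "left_kernel (x - y) = left_kernel (y - x)"
  using left_kernel_uminus[of "x - y"] by simp

lemma card_left_kernel_minus_outer_ge:
  fixes M :: "'a::{field,finite}^'n^'m"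
  shows "card (left_kernel M) \<le> CARD('a) * card (left_kernel (M - outer u v))"
proof -
  have "outer_type M u v = 1 \<or> outer_type M u v = 6 \<or> outer_type M u v \<in> {2..5}"
    using outer_type_mem[of M u v] by auto
  moreover have "card (left_kernel M) \<le> CARD('a) * (CARD('a) * card (left_kernel M))"
    by (simp add: Suc_leI)
  ultimately show ?thesis
    using card_left_kernel_minus_outer_type[of M u v] by (auto simp: Suc_leI)
qed

text \<open>This supplies the step that lowers the rank of a nonzero difference and so starts a
  shortest walk. A nonzero row of \<open>M\<close> serves as \<open>v\<close>.\<close>

lemma ex_outer_type_1:
  assumes "M \<noteq> 0"
  obtains u v where "u \<noteq> 0" "v \<noteq> 0" "outer_type M u v = 1"
proof -
  obtain i where "M $ i \<noteq> 0"
    using assms by (auto simp: vec_eq_iff)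
  moreover have "axis i 1 v* M = M $ i"
    by (simp add: vec_eq_iff vector_matrix_mult_def axis_def if_distrib if_distribR cong: if_cong)
  ultimately have r: "axis i 1 v* M \<noteq> 0"
    by simp
  then obtain u where u: "u \<in> col_space M" "axis i 1 \<cdot> u = 1"
    using ex_col_space_dotp_eq_1[of "axis i 1" M] by (auto simp: left_kernel_def)
  have "outer_type M u (axis i 1 v* M) = 1"
    using u pairing_vector_mult[OF u(1)] by (simp add: outer_type_def row_space_def)
  moreover have "u \<noteq> 0"
    using u(2) by auto
  ultimately show thesis
    using that r by blast
qed

section \<open>Distances and the partition of the neighbours\<close>

abbreviation bilinear_dist :: "'a::field^'n^'m \<Rightarrow> 'a^'n^'m \<Rightarrow> nat" where
  "bilinear_dist \<equiv> graph_dist bilinear_adj"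

lemma bilinear_adj_iff:
  "bilinear_adj x z \<longleftrightarrow> (\<exists>u v. u \<noteq> 0 \<and> v \<noteq> 0 \<and> z = x + outer u v)"
proof -
  have "x - z = w \<longleftrightarrow> z = x + - w" for w
    by auto
  then have e: "x - z = outer u v \<longleftrightarrow> z = x + outer (- u) v" for u v
    by (simp only: outer_linear)
  have "bilinear_adj x z \<longleftrightarrow> (\<exists>u v. u \<noteq> 0 \<and> v \<noteq> 0 \<and> x - z = outer u v)"
    unfolding bilinear_adj_def rank_eq_1_iff ..
  also have "\<dots> \<longleftrightarrow> (\<exists>u v. u \<noteq> 0 \<and> v \<noteq> 0 \<and> z = x + outer (- u) v)"
    by (simp only: e)
  also have "\<dots> \<longleftrightarrow> (\<exists>u v. u \<noteq> 0 \<and> v \<noteq> 0 \<and> z = x + outer u v)"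
    by (metis neg_equal_0_iff_equal minus_minus)
  finally show ?thesis .
qed

lemma field_card_gt_1: "1 < CARD('a::{field,finite})"
proof -
  have "card {0, 1 :: 'a} \<le> CARD('a)"
    by (rule card_mono) auto
  then show ?thesis by simp
qed

lemma card_left_kernel_walk_ge:
  fixes x y :: "'a::{field,finite}^'n^'m"
  assumes "(bilinear_adj ^^ n) x y"
  shows "CARD('a) ^ CARD('m) \<le> card (left_kernel (x - y)) * CARD('a) ^ n"
  using assms
proof (induction n arbitrary: y)
  case 0
  then have "left_kernel (x - y) = UNIV"
    by (simp add: left_kernel_def)
  then show ?case
    by simp
next
  case (Suc n)
  then obtain z where z: "(bilinear_adj ^^ n) x z" "bilinear_adj z y"
    by auto
  then obtain u v where "y = z + outer u v"
    by (auto simp: bilinear_adj_iff)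
  then have xy: "x - y = (x - z) - outer u v"
    by simp
  have "CARD('a) ^ CARD('m) \<le> card (left_kernel (x - z)) * CARD('a) ^ n"
    using Suc.IH z(1) .
  also have "\<dots> \<le> CARD('a) * card (left_kernel (x - y)) * CARD('a) ^ n"
    unfolding xy by (intro mult_right_mono card_left_kernel_minus_outer_ge) simp
  finally show ?case
    by (simp add: mult_ac)
qed

text \<open>Steps of type 1 multiply the left kernel of the difference by q each time, until it is
  the whole space and the walk has arrived at \<open>y\<close>. The induction is on the number of
  vectors still missing from the kernel.\<close>

lemma ex_walk_card_left_kernel:
  fixes x y :: "'a::{field,finite}^'n^'m"
  shows "\<exists>n. (bilinear_adj ^^ n) x y \<and> card (left_kernel (x - y)) * CARD('a) ^ n = CARD('a) ^ CARD('m)"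
proof (induction x rule: measure_induct_rule[where f = "\<lambda>x. CARD('a) ^ CARD('m) - card (left_kernel (x - y))"])
  case (less x)
  show ?case
  proof (cases "x = y")
    case True
    have "left_kernel (x - y) = UNIV"
      by (simp add: True left_kernel_def)
    then show ?thesis
      using True by (intro exI[of _ 0]) simp
  next
    case False
    then obtain u v where uv: "u \<noteq> 0" "v \<noteq> 0" "outer_type (x - y) u v = 1"
      using ex_outer_type_1[of "x - y"] by auto
    define z where "z = x - outer u v"
    have c: "card (left_kernel (z - y)) = CARD('a) * card (left_kernel (x - y))"
      using card_left_kernel_minus_outer_type(1)[OF uv(3)] by (simp add: z_def algebra_simps)
    moreover have "card (left_kernel (z - y)) \<le> CARD('a) ^ CARD('m)"
      using card_mono[of UNIV "left_kernel (z - y)"] by simp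
    moreover have "card (left_kernel (x - y)) < CARD('a) * card (left_kernel (x - y))"
      using field_card_gt_1[where 'a = 'a] card_left_kernel_pos[of "x - y"] by simp
    ultimately have "CARD('a) ^ CARD('m) - card (left_kernel (z - y)) < CARD('a) ^ CARD('m) - card (left_kernel (x - y))"
      by linarith
    then obtain n where n: "(bilinear_adj ^^ n) z y"
      "card (left_kernel (z - y)) * CARD('a) ^ n = CARD('a) ^ CARD('m)"
      using less by blast
    have "z = x + outer (- u) v"
      by (simp add: z_def outer_linear)
    then have "bilinear_adj x z"
      using uv bilinear_adj_iff by (metis neg_equal_0_iff_equal)
    then have "(bilinear_adj ^^ Suc n) x y"
      using n(1) by (rule relpowp_Suc_I2)
    moreover have "card (left_kernel (x - y)) * CARD('a) ^ Suc n = CARD('a) ^ CARD('m)"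
      using n(2) c by (simp add: mult_ac)
    ultimately show ?thesis
      by blast
  qed
qed

text \<open>The second equation says that distance is rank. The walk of type 1 steps attains it, and
  no walk is shorter since one step divides the size of the left kernel by at most q.\<close>

lemma bilinear_dist:
  fixes x y :: "'a::{field,finite}^'n^'m"
  shows "(bilinear_adj ^^ bilinear_dist x y) x y"
    and "card (left_kernel (x - y)) * CARD('a) ^ bilinear_dist x y = CARD('a) ^ CARD('m)"
proof -
  obtain n where n: "(bilinear_adj ^^ n) x y"
    "card (left_kernel (x - y)) * CARD('a) ^ n = CARD('a) ^ CARD('m)"
    using ex_walk_card_left_kernel by blast
  have "bilinear_dist x y = n"
    unfolding graph_dist_def
  proof (rule Least_equality)
    fix l assume "(bilinear_adj ^^ l) x y"
    then have "card (left_kernel (x - y)) * CARD('a) ^ n \<le> card (left_kernel (x - y)) * CARD('a) ^ l"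
      using card_left_kernel_walk_ge[of l x y] n(2) by simp
    then show "n \<le> l"
      using field_card_gt_1[where 'a = 'a] card_left_kernel_pos[of "x - y"] by simp
  qed (fact n(1))
  then show "(bilinear_adj ^^ bilinear_dist x y) x y"
    and "card (left_kernel (x - y)) * CARD('a) ^ bilinear_dist x y = CARD('a) ^ CARD('m)"
    using n by simp_all
qed

lemma bilinear_dist_eq_iff:
  fixes x y :: "'a::{field,finite}^'n^'m"
  shows "bilinear_dist x y = j \<longleftrightarrow> card (left_kernel (x - y)) * CARD('a) ^ j = CARD('a) ^ CARD('m)"
proof
  assume "card (left_kernel (x - y)) * CARD('a) ^ j = CARD('a) ^ CARD('m)"
  then have "card (left_kernel (x - y)) * CARD('a) ^ j = card (left_kernel (x - y)) * CARD('a) ^ bilinear_dist x y"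
    using bilinear_dist(2)[of x y] by simp
  then show "bilinear_dist x y = j"
    using field_card_gt_1[where 'a = 'a] card_left_kernel_pos[of "x - y"] by auto
qed (use bilinear_dist(2) in blast)

lemma bilinear_dist_eq_1_iff:
  fixes x z :: "'a::{field,finite}^'n^'m"
  shows "bilinear_dist x z = 1 \<longleftrightarrow> (\<exists>u v. u \<noteq> 0 \<and> v \<noteq> 0 \<and> z = x + outer u v)"
proof
  assume "bilinear_dist x z = 1"
  then have "bilinear_adj x z"
    using bilinear_dist(1)[of x z] relpowp_1[of bilinear_adj] by metis
  then show "\<exists>u v. u \<noteq> 0 \<and> v \<noteq> 0 \<and> z = x + outer u v"
    by (simp add: bilinear_adj_iff)
next
  assume "\<exists>u v. u \<noteq> 0 \<and> v \<noteq> 0 \<and> z = x + outer u v"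
  then obtain u v where uv: "u \<noteq> 0" "v \<noteq> 0" "z = x + outer u v"
    by blast
  have "left_kernel (x - z) = {p. p \<cdot> u = 0}"
    using uv by (auto simp: left_kernel_def)
  then show "bilinear_dist x z = 1"
    unfolding bilinear_dist_eq_iff using card_dotp_fibre(1)[OF uv(1), of 0] by (simp add: mult.commute)
qed

lemma bilinear_dist_add_outer:
  fixes x y :: "'a::{field,finite}^'n^'m"
  assumes "1 \<le> bilinear_dist x y"
  shows "bilinear_dist y (x + outer u v) =
    (if outer_type (y - x) u v = 1 then bilinear_dist x y - 1
     else if outer_type (y - x) u v = 6 then bilinear_dist x y + 1 else bilinear_dist x y)"
proof -
  define k where "k = bilinear_dist x y"
  have k: "card (left_kernel (y - x)) * CARD('a) ^ k = CARD('a) ^ CARD('m)" "k = Suc (k - 1)"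
    using bilinear_dist(2)[of x y] assms left_kernel_diff_commute[of x y] by (simp_all add: k_def)
  have e: "y - (x + outer u v) = (y - x) - outer u v"
    by simp
  note c = card_left_kernel_minus_outer_type[of "y - x" u v]
  consider "outer_type (y - x) u v = 1" | "outer_type (y - x) u v = 6" | "outer_type (y - x) u v \<in> {2..5}"
    using outer_type_mem[of "y - x" u v] by fastforce
  then show ?thesis
    unfolding k_def[symmetric]
  proof cases
    case 1
    have "bilinear_dist y (x + outer u v) = k - 1"
      unfolding bilinear_dist_eq_iff e c(1)[OF 1] using k by (metis mult.assoc mult.commute power_Suc)
    then show "bilinear_dist y (x + outer u v) = (if outer_type (y - x) u v = 1 then k - 1
      else if outer_type (y - x) u v = 6 then k + 1 else k)"
      using 1 by simp
  next
    case 2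
    have "bilinear_dist y (x + outer u v) = k + 1"
      unfolding bilinear_dist_eq_iff e k(1)[symmetric] c(2)[OF 2, symmetric] by simp
    then show "bilinear_dist y (x + outer u v) = (if outer_type (y - x) u v = 1 then k - 1
      else if outer_type (y - x) u v = 6 then k + 1 else k)"
      using 2 by simp
  next
    case 3
    have "bilinear_dist y (x + outer u v) = k"
      unfolding bilinear_dist_eq_iff e c(3)[OF 3] by (fact k(1))
    then show "bilinear_dist y (x + outer u v) = (if outer_type (y - x) u v = 1 then k - 1
      else if outer_type (y - x) u v = 6 then k + 1 else k)"
      using 3 by auto
  qed
qed

section \<open>Neighbours of a given type and their common neighbours\<close>

definition sector :: "'a::field^'n^'m \<Rightarrow> nat set \<Rightarrow> ('a^'n^'m) set" where
  "sector M J = {outer u v | u v. u \<noteq> 0 \<and> v \<noteq> 0 \<and> outer_type M u v \<in> J}"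

lemma outer_cancel:
  shows "v \<noteq> 0 \<Longrightarrow> outer u v = outer u' v \<longleftrightarrow> u = u'"
    and "u \<noteq> 0 \<Longrightarrow> outer u v = outer u v' \<longleftrightarrow> v = v'"
  using outer_eq_0_iff[of "u - u'" v] outer_eq_0_iff[of u "v - v'"] by (auto simp: outer_linear)

lemma outer_in_sector_iff:
  assumes "u \<noteq> 0" "v \<noteq> 0"
  shows "outer u v \<in> sector M J \<longleftrightarrow> outer_type M u v \<in> J"
proof
  assume "outer u v \<in> sector M J"
  then obtain u' v' where e: "outer u v = outer u' v'" "outer_type M u' v' \<in> J"
    by (auto simp: sector_def)
  obtain c where "c \<noteq> 0" "u = c *s u'" "v' = c *s v"
    using outer_eq_iff[OF e(1) assms] by blast
  then show "outer_type M u v \<in> J"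
    using e(2) by (simp add: outer_type_scale)
qed (use assms in \<open>auto simp: sector_def\<close>)

text \<open>Zero factors also receive a type, but never 1 or 6. Hence the counts of vectors giving
  type 1 or 6 need no correction for zero, while counts for a general set of types do.\<close>

lemma outer_type_0:
  shows "outer_type M 0 v \<in> {2, 4}" and "outer_type M u 0 = (if u \<in> col_space M then 2 else 5)"
proof -
  have "0 \<in> col_space M" "0 \<in> row_space M"
    using subspace_col_space subspace_row_space vec.subspace_0 by blast+
  moreover have "pairing M u 0 = 0" if "u \<in> col_space M"
    using pairing_vector_mult[OF that, of 0] by simp
  ultimately show "outer_type M 0 v \<in> {2, 4}"
    and "outer_type M u 0 = (if u \<in> col_space M then 2 else 5)"
    by (auto simp: outer_type_def pairing_def)
qed

text \<open>The pairing is nondegenerate on both sides: a nonzero \<open>r v* M\<close> has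
  \<open>r\<close> outside the left kernel, so some \<open>u\<close> in the column space has
  \<open>r \<cdot> u = 1\<close>; and a nonzero \<open>u\<close> has \<open>r \<cdot> u = 1\<close>
  for some \<open>r\<close>. So every value is taken equally often.\<close>

lemma card_pairing_fibre:
  fixes M :: "'a::{field,finite}^'n^'m"
  shows "v \<in> row_space M \<Longrightarrow> v \<noteq> 0 \<Longrightarrow>
      CARD('a) * card {u \<in> col_space M. pairing M u v = b} = card (col_space M)"
    and "u \<in> col_space M \<Longrightarrow> u \<noteq> 0 \<Longrightarrow>
      CARD('a) * card {v \<in> row_space M. pairing M u v = b} = card (row_space M)"
proof -
  assume v: "v \<in> row_space M" "v \<noteq> 0"
  then obtain r where r: "v = r v* M"
    by (auto simp: row_space_def)
  then obtain u where u: "u \<in> col_space M" "r \<cdot> u = 1"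
    using ex_col_space_dotp_eq_1[of r M] v(2) by (auto simp: left_kernel_def)
  show "CARD('a) * card {u \<in> col_space M. pairing M u v = b} = card (col_space M)"
    by (rule card_fibre_linear[where ?g0.0 = u])
      (use u v pairing_vector_mult[OF u(1), of r] r in \<open>simp_all add: subspace_col_space pairing_linear\<close>)
next
  assume u: "u \<in> col_space M" "u \<noteq> 0"
  obtain r where r: "r \<cdot> u = 1"
    using ex_dotp_eq_1[OF u(2)] by metis
  have "r v* M \<in> row_space M"
    by (simp add: row_space_def)
  then show "CARD('a) * card {v \<in> row_space M. pairing M u v = b} = card (row_space M)"
    by (rule card_fibre_linear[where ?g0.0 = "r v* M", rotated 3])
      (use u r pairing_vector_mult[OF u(1), of r] in \<open>simp_all add: subspace_row_space pairing_linear\<close>)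
qed

lemma card_outer_type_left:
  fixes M :: "'a::{field,finite}^'n^'m"
  assumes "v \<noteq> 0"
  shows "CARD('a) * card {u. outer_type M u v = 1} = (if v \<in> row_space M then card (col_space M) else 0)"
    and "card {u. outer_type M u v = 6} = (if v \<in> row_space M then 0 else card (- col_space M))"
proof -
  have "{u. outer_type M u v = 1} = (if v \<in> row_space M then {u \<in> col_space M. pairing M u v = 1} else {})"
    by (auto simp: outer_type_def)
  then show "CARD('a) * card {u. outer_type M u v = 1} = (if v \<in> row_space M then card (col_space M) else 0)"
    using card_pairing_fibre(1)[OF _ assms, of M 1] by simp
  have "{u. outer_type M u v = 6} = (if v \<in> row_space M then {} else - col_space M)"
    by (auto simp: outer_type_def)
  then show "card {u. outer_type M u v = 6} = (if v \<in> row_space M then 0 else card (- col_space M))"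
    by simp
qed

lemma card_outer_type_right:
  fixes M :: "'a::{field,finite}^'n^'m"
  assumes "u \<noteq> 0"
  shows "CARD('a) * card {v. outer_type M u v = 1} = (if u \<in> col_space M then card (row_space M) else 0)"
    and "card {v. outer_type M u v = 6} = (if u \<in> col_space M then 0 else card (- row_space M))"
proof -
  have "{v. outer_type M u v = 1} = (if u \<in> col_space M then {v \<in> row_space M. pairing M u v = 1} else {})"
    by (auto simp: outer_type_def)
  then show "CARD('a) * card {v. outer_type M u v = 1} = (if u \<in> col_space M then card (row_space M) else 0)"
    using card_pairing_fibre(2)[OF _ assms, of M 1] by simp
  have "{v. outer_type M u v = 6} = (if u \<in> col_space M then {} else - row_space M)"
    by (auto simp: outer_type_def)
  then show "card {v. outer_type M u v = 6} = (if u \<in> col_space M then 0 else card (- row_space M))"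
    by simp
qed

text \<open>Along the multiples of \<open>u\<close> the pairing with \<open>v\<close> is linear, so
  it takes the value 1 exactly once unless it is zero. This single multiple separates types 2 and 3;
  it is the origin of the -1 in the definition of \<open>O_3\<close>.\<close>

lemma card_outer_type_scale:
  fixes M :: "'a::{field,finite}^'n^'m"
  assumes "u \<noteq> 0" "v \<noteq> 0" "outer_type M u v \<in> {2..5}"
  shows "card {c. outer_type M (c *s u) v = 1} = (if outer_type M u v = 3 then 1 else 0)"
    and "card {c. outer_type M (c *s u) v = 6} = 0"
proof -
  have col: "c *s u \<in> col_space M" if "u \<in> col_space M" for c
    using that subspace_col_space vec.subspace_scale by blast
  have "u \<in> col_space M \<or> v \<in> row_space M"
    using assms(3) by (auto simp: outer_type_def split: if_splits)
  then have "outer_type M (c *s u) v \<noteq> 6" for c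
    using col by (auto simp: outer_type_def)
  then show "card {c. outer_type M (c *s u) v = 6} = 0"
    by simp
  have col_iff: "c *s u \<in> col_space M \<longleftrightarrow> u \<in> col_space M" if "c \<noteq> 0" for c
    using in_subspace_scale_iff[OF subspace_col_space that] .
  show "card {c. outer_type M (c *s u) v = 1} = (if outer_type M u v = 3 then 1 else 0)"
  proof (cases "u \<in> col_space M \<and> v \<in> row_space M")
    case True
    have "outer_type M (c *s u) v = 1 \<longleftrightarrow> c * pairing M u v = 1" for c
      using True col[of c] by (simp add: outer_type_def pairing_linear)
    moreover have "c * d = 1 \<longleftrightarrow> d \<noteq> 0 \<and> c = inverse d" for c d :: 'a
      using inverse_unique[of d c] by (auto simp: mult.commute)
    ultimately have "{c. outer_type M (c *s u) v = 1} =
        (if pairing M u v = 0 then {} else {inverse (pairing M u v)})"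
      by auto
    then show ?thesis
      using True assms(3) by (auto simp: outer_type_def)
  next
    case False
    have "outer_type M (c *s u) v \<noteq> 1" for c
    proof (cases "c = 0")
      case True
      then show ?thesis
        using outer_type_0(1)[of M v] by auto
    next
      case c: False
      then show ?thesis
        using False col_iff[OF c] by (auto simp: outer_type_def)
    qed
    then show ?thesis
      using False by (auto simp: outer_type_def)
  qed
qed

lemma bilinear_dist_isometry:
  fixes x y w :: "'a::{field,finite}^'n^'m"
  shows "bilinear_dist (w + x) (w + y) = bilinear_dist x y"
    and "bilinear_dist (w - x) (w - y) = bilinear_dist x y"
    and "bilinear_dist y x = bilinear_dist x y"
  unfolding bilinear_dist_eq_iff using bilinear_dist(2)[of x y] left_kernel_diff_commute[of x y]
  by simp_all

text \<open>If two rank one matrices differ by a matrix of rank one, they share a factor up to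
  scaling. So the neighbours counted here either keep \<open>v\<close> (the set \<open>P\<close>) or
  keep \<open>u\<close> (the set \<open>Q\<close>), and the overlap consists of scalar multiples of
  \<open>outer u v\<close>: inclusion-exclusion, written with sums to avoid subtraction.\<close>

lemma card_neighbours_in_sector:
  fixes M :: "'a::{field,finite}^'n^'m"
  assumes uv: "u \<noteq> 0" "v \<noteq> 0" "outer_type M u v \<in> {2..5}" and t: "t = 1 \<or> t = 6"
  shows "card {s \<in> sector M {t}. bilinear_dist (outer u v) s = 1} + card {c. outer_type M (c *s u) v = t}
    = card {u'. outer_type M u' v = t} + card {v'. outer_type M u v' = t}"
proof -
  define P where "P = (\<lambda>u'. outer u' v) ` {u'. outer_type M u' v = t}"
  define Q where "Q = (\<lambda>v'. outer u v') ` {v'. outer_type M u v' = t}"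
  have nz: "u' \<noteq> 0 \<and> v' \<noteq> 0" if "outer_type M u' v' = t" for u' v'
    using that t outer_type_0(1)[of M v'] outer_type_0(2)[of M u'] by (auto split: if_splits)
  have neq: "outer_type M u v \<noteq> t"
    using uv(3) t by auto
  have "{s \<in> sector M {t}. bilinear_dist (outer u v) s = 1} = P \<union> Q"
  proof (intro subset_antisym subsetI)
    fix s assume "s \<in> {s \<in> sector M {t}. bilinear_dist (outer u v) s = 1}"
    then have s: "s \<in> sector M {t}" "bilinear_dist (outer u v) s = 1"
      by auto
    from s(1) obtain u' v' where s': "s = outer u' v'" "u' \<noteq> 0" "v' \<noteq> 0" "outer_type M u' v' = t"
      by (auto simp: sector_def)
    from s(2) obtain a b where ab: "a \<noteq> 0" "b \<noteq> 0" "s = outer u v + outer a b"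
      unfolding bilinear_dist_eq_1_iff by blast
    have "outer u v - outer u' v' = outer (- a) b"
      using ab(3) s'(1) by (simp add: outer_linear)
    then have "rank (outer u v - outer u' v') = 1"
      using ab by (metis neg_equal_0_iff_equal rank_eq_1_iff)
    then consider c where "u' = c *s u" | c where "v' = c *s v"
      using proportional_if_rank_diff_1[OF uv(1,2)] by blast
    then show "s \<in> P \<union> Q"
    proof cases
      case 1
      then have "c \<noteq> 0"
        using s' by auto
      then have "s = outer u (c *s v')" "outer_type M u (c *s v') = t"
        using 1 s' by (simp_all add: outer_linear outer_type_scale)
      then show ?thesis
        by (auto simp: Q_def)
    next
      case 2
      then have "c \<noteq> 0"
        using s' by auto
      then have "s = outer (c *s u') v" "outer_type M (c *s u') v = t"
        using 2 s' by (simp_all add: outer_linear outer_type_scale)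
      then show ?thesis
        by (auto simp: P_def)
    qed
  next
    fix s assume "s \<in> P \<union> Q"
    then consider u' where "s = outer u' v" "outer_type M u' v = t"
      | v' where "s = outer u v'" "outer_type M u v' = t"
      by (auto simp: P_def Q_def)
    then show "s \<in> {s \<in> sector M {t}. bilinear_dist (outer u v) s = 1}"
    proof cases
      case 1
      then have "s \<in> sector M {t}"
        using nz by (auto simp: sector_def)
      moreover have "s = outer u v + outer (u' - u) v" "u' - u \<noteq> 0"
        using 1 neq by (auto simp: outer_linear)
      ultimately show ?thesis
        using uv(2) unfolding mem_Collect_eq bilinear_dist_eq_1_iff by blast
    next
      case 2
      then have "s \<in> sector M {t}"
        using nz by (auto simp: sector_def)
      moreover have "s = outer u v + outer u (v' - v)" "v' - v \<noteq> 0"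
        using 2 neq by (auto simp: outer_linear)
      ultimately show ?thesis
        using uv(1) unfolding mem_Collect_eq bilinear_dist_eq_1_iff by blast
    qed
  qed
  moreover have "P \<inter> Q = (\<lambda>c. outer (c *s u) v) ` {c. outer_type M (c *s u) v = t}"
  proof (intro subset_antisym subsetI)
    fix s assume "s \<in> P \<inter> Q"
    then obtain u' v' where e: "s = outer u' v" "outer_type M u' v = t" "outer u' v = outer u v'"
      by (auto simp: P_def Q_def)
    then obtain c where "u' = c *s u"
      using outer_eq_iff[OF e(3)] nz by metis
    then show "s \<in> (\<lambda>c. outer (c *s u) v) ` {c. outer_type M (c *s u) v = t}"
      using e by (intro image_eqI[of _ _ c]) simp_all
  next
    fix s assume "s \<in> (\<lambda>c. outer (c *s u) v) ` {c. outer_type M (c *s u) v = t}"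
    then obtain c where c: "s = outer (c *s u) v" "outer_type M (c *s u) v = t"
      by blast
    then have "c \<noteq> 0"
      using nz by fastforce
    then have "s = outer u (c *s v)" "outer_type M u (c *s v) = t"
      using c by (simp_all add: outer_linear outer_type_scale)
    then show "s \<in> P \<inter> Q"
      using c unfolding P_def Q_def by blast
  qed
  moreover have "card P = card {u'. outer_type M u' v = t}"
    unfolding P_def using uv by (intro card_image inj_onI) (simp add: outer_cancel)
  moreover have "card Q = card {v'. outer_type M u v' = t}"
    unfolding Q_def using uv by (intro card_image inj_onI) (simp add: outer_cancel)
  moreover have "card ((\<lambda>c. outer (c *s u) v) ` {c. outer_type M (c *s u) v = t}) = card {c. outer_type M (c *s u) v = t}"
    using uv by (intro card_image inj_onI) (simp add: outer_cancel(1))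
  moreover have "card P + card Q = card (P \<union> Q) + card (P \<inter> Q)"
    by (rule card_Un_Int) simp_all
  ultimately show ?thesis
    by simp
qed

text \<open>The three terms of \<open>card_neighbours_in_sector\<close> depend only on whether
  \<open>u\<close> is in the column space, whether \<open>v\<close> is in the row space and whether
  the type is 3, all of which the type determines.\<close>

lemma card_neighbours_in_sector_cong:
  fixes M :: "'a::{field,finite}^'n^'m"
  assumes uv: "u \<noteq> 0" "v \<noteq> 0" "outer_type M u v \<in> {2..5}"
    and uv': "u' \<noteq> 0" "v' \<noteq> 0" "outer_type M u' v' = outer_type M u v"
    and t: "t = 1 \<or> t = 6"
  shows "card {s \<in> sector M {t}. bilinear_dist (outer u v) s = 1} =
    card {s \<in> sector M {t}. bilinear_dist (outer u' v') s = 1}"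
proof -
  have ty: "outer_type M u' v' \<in> {2..5}"
    using uv uv' by simp
  have iff: "u \<in> col_space M \<longleftrightarrow> u' \<in> col_space M" "v \<in> row_space M \<longleftrightarrow> v' \<in> row_space M"
    using uv'(3) by (auto simp: outer_type_def split: if_splits)
  have cancel: "CARD('a) * m = CARD('a) * n \<Longrightarrow> m = n" for m n
    by simp
  have "card {a. outer_type M a v = t} = card {a. outer_type M a v' = t}"
  proof -
    have "card {a. outer_type M a v = 1} = card {a. outer_type M a v' = 1}"
      by (rule cancel) (simp only: card_outer_type_left(1)[OF uv(2)] card_outer_type_left(1)[OF uv'(2)] iff)
    moreover have "card {a. outer_type M a v = 6} = card {a. outer_type M a v' = 6}"
      by (simp only: card_outer_type_left(2)[OF uv(2)] card_outer_type_left(2)[OF uv'(2)] iff)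
    ultimately show ?thesis
      using t by blast
  qed
  moreover have "card {a. outer_type M u a = t} = card {a. outer_type M u' a = t}"
  proof -
    have "card {a. outer_type M u a = 1} = card {a. outer_type M u' a = 1}"
      by (rule cancel) (simp only: card_outer_type_right(1)[OF uv(1)] card_outer_type_right(1)[OF uv'(1)] iff)
    moreover have "card {a. outer_type M u a = 6} = card {a. outer_type M u' a = 6}"
      by (simp only: card_outer_type_right(2)[OF uv(1)] card_outer_type_right(2)[OF uv'(1)] iff)
    ultimately show ?thesis
      using t by blast
  qed
  moreover have "card {c. outer_type M (c *s u) v = t} = card {c. outer_type M (c *s u') v' = t}"
    using t card_outer_type_scale[OF uv] card_outer_type_scale[OF uv'(1,2) ty] uv'(3) by auto
  ultimately show ?thesis
    using card_neighbours_in_sector[OF uv t] card_neighbours_in_sector[OF uv'(1,2) ty t] by simp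
qed

lemma sphere_Int_sphere_eq_sector:
  fixes x y :: "'a::{field,finite}^'n^'m"
  assumes k: "k = bilinear_dist x y" "1 \<le> k"
  shows "sphere_at bilinear_adj 1 x \<inter> sphere_at bilinear_adj (k - 1) y = (+) x ` sector (y - x) {1}"
    and "sphere_at bilinear_adj 1 x \<inter> sphere_at bilinear_adj (k + 1) y = (+) x ` sector (y - x) {6}"
    and "sphere_at bilinear_adj 1 x \<inter> sphere_at bilinear_adj k y = (+) x ` sector (y - x) {2..5}"
proof -
  have *: "sphere_at bilinear_adj 1 x \<inter> sphere_at bilinear_adj j y = (+) x ` sector (y - x) J"
    if J: "\<And>u v. bilinear_dist y (x + outer u v) = j \<longleftrightarrow> outer_type (y - x) u v \<in> J" for j J
  proof (rule set_eqI)
    fix z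
    have "z \<in> sphere_at bilinear_adj 1 x \<inter> sphere_at bilinear_adj j y \<longleftrightarrow>
        (\<exists>u v. u \<noteq> 0 \<and> v \<noteq> 0 \<and> z = x + outer u v \<and> bilinear_dist y z = j)"
      unfolding sphere_at_def Int_iff mem_Collect_eq bilinear_dist_eq_1_iff by blast
    also have "\<dots> \<longleftrightarrow> (\<exists>u v. u \<noteq> 0 \<and> v \<noteq> 0 \<and> z = x + outer u v \<and> outer_type (y - x) u v \<in> J)"
      by (metis J)
    also have "\<dots> \<longleftrightarrow> z \<in> (+) x ` sector (y - x) J"
      unfolding sector_def by blast
    finally show "z \<in> sphere_at bilinear_adj 1 x \<inter> sphere_at bilinear_adj j y \<longleftrightarrow> z \<in> (+) x ` sector (y - x) J" .
  qed
  have d: "bilinear_dist y (x + outer u v) = (if outer_type (y - x) u v = 1 then k - 1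
    else if outer_type (y - x) u v = 6 then k + 1 else k)" for u v
    using bilinear_dist_add_outer[of x y u v] k by simp
  have mem: "outer_type (y - x) u v \<in> {1..6}" for u v
    by (rule outer_type_mem)
  show "sphere_at bilinear_adj 1 x \<inter> sphere_at bilinear_adj (k - 1) y = (+) x ` sector (y - x) {1}"
    by (rule *) (use k in \<open>auto simp: d\<close>)
  show "sphere_at bilinear_adj 1 x \<inter> sphere_at bilinear_adj (k + 1) y = (+) x ` sector (y - x) {6}"
    by (rule *) (use k in \<open>auto simp: d\<close>)
  show "sphere_at bilinear_adj 1 x \<inter> sphere_at bilinear_adj k y = (+) x ` sector (y - x) {2..5}"
  proof (rule *)
    fix u v
    show "bilinear_dist y (x + outer u v) = k \<longleftrightarrow> outer_type (y - x) u v \<in> {2..5}"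
      using mem[of u v] k unfolding d by auto
  qed
qed

lemma card_common_neighbours:
  fixes x y s :: "'a::{field,finite}^'n^'m"
  assumes "sphere_at bilinear_adj 1 x \<inter> sphere_at bilinear_adj j y = (+) x ` sector M {t}"
  shows "card (sphere_at bilinear_adj 1 x \<inter> sphere_at bilinear_adj 1 (x + s) \<inter> sphere_at bilinear_adj j y)
    = card {s' \<in> sector M {t}. bilinear_dist s s' = 1}"
proof -
  have "sphere_at bilinear_adj 1 x \<inter> sphere_at bilinear_adj 1 (x + s) \<inter> sphere_at bilinear_adj j y
    = (+) x ` sector M {t} \<inter> {w. bilinear_dist (x + s) w = 1}"
    using assms by (auto simp: sphere_at_def)
  also have "\<dots> = (+) x ` {s' \<in> sector M {t}. bilinear_dist s s' = 1}"
    using bilinear_dist_isometry(1)[of x s] by auto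
  finally show ?thesis
    by (simp add: card_image)
qed

text \<open>Since a and b are constant on types, prescribing their values cuts out a union of types.
  The prescribed numbers enter only through the set \<open>J\<close> of types on which they are
  attained.\<close>

lemma y_partition_eq_sector:
  fixes x y :: "'a::{field,finite}^'n^'m"
  assumes "2 \<le> bilinear_dist x y" and i: "i \<in> {1..6}"
  obtains J where "y_partition bilinear_adj q D N x y i = (+) x ` sector (y - x) J"
    and "i = 1 \<Longrightarrow> J = {1}" and "i = 6 \<Longrightarrow> J = {6}" and "i \<in> {2..5} \<Longrightarrow> J \<subseteq> {2..5}"
proof -
  define k where "k = bilinear_dist x y"
  define M where "M = y - x"
  have k: "k = bilinear_dist x y" "1 \<le> k"
    using assms by (simp_all add: k_def)
  note sph = sphere_Int_sphere_eq_sector[OF k, folded M_def]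
  define a where "a z = card (sphere_at bilinear_adj 1 x \<inter> sphere_at bilinear_adj 1 z \<inter> sphere_at bilinear_adj (k - 1) y)" for z
  define b where "b z = card (sphere_at bilinear_adj 1 x \<inter> sphere_at bilinear_adj 1 z \<inter> sphere_at bilinear_adj (k + 1) y)" for z
  define P where "P s t = {z \<in> sphere_at bilinear_adj 1 x \<inter> sphere_at bilinear_adj k y. a z = s \<and> b z = t}" for s t
  have part: "y_partition bilinear_adj q D N x y i =
    (if i = 1 then sphere_at bilinear_adj 1 x \<inter> sphere_at bilinear_adj (k - 1) y
         else if i = 2 then P (2 * q ^ (k - 1)) 0
         else if i = 3 then P (2 * q ^ (k - 1) - 1) 0
         else if i = 4 then P (q ^ (k - 1)) (q ^ D - q ^ k)
         else if i = 5 then P (q ^ (k - 1)) (q ^ (N - D) - q ^ k)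
         else if i = 6 then sphere_at bilinear_adj 1 x \<inter> sphere_at bilinear_adj (k + 1) y
         else {})"
    unfolding y_partition_def Let_def P_def a_def b_def k_def ..
  have P: "\<exists>J. J \<subseteq> {2..5} \<and> P s t = (+) x ` sector M J" for s t
  proof (intro exI conjI)
    define J where "J = {j \<in> {2..5}. \<exists>u v. u \<noteq> 0 \<and> v \<noteq> 0 \<and> outer_type M u v = j \<and>
      a (x + outer u v) = s \<and> b (x + outer u v) = t}"
    show "J \<subseteq> {2..5}"
      by (auto simp: J_def)
    have cong: "a (x + outer u v) = a (x + outer u' v') \<and> b (x + outer u v) = b (x + outer u' v')"
      if "u \<noteq> 0" "v \<noteq> 0" "outer_type M u v \<in> {2..5}" "u' \<noteq> 0" "v' \<noteq> 0" "outer_type M u' v' = outer_type M u v"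
      for u v u' v'
      unfolding a_def b_def card_common_neighbours[OF sph(1)] card_common_neighbours[OF sph(2)]
      using card_neighbours_in_sector_cong[OF that] by simp
    have mem: "x + outer u v \<in> P s t \<longleftrightarrow> x + outer u v \<in> (+) x ` sector M J" if uv: "u \<noteq> 0" "v \<noteq> 0" for u v
    proof -
      have "x + outer u v \<in> (+) x ` sector M I \<longleftrightarrow> outer_type M u v \<in> I" for I
        using outer_in_sector_iff[OF uv] by auto
      then have J: "x + outer u v \<in> (+) x ` sector M J \<longleftrightarrow> outer_type M u v \<in> J"
        and "x + outer u v \<in> P s t \<longleftrightarrow> outer_type M u v \<in> {2..5} \<and> a (x + outer u v) = s \<and> b (x + outer u v) = t"
        unfolding P_def sph(3) by blast+
      note this(2)
      also have "\<dots> \<longleftrightarrow> outer_type M u v \<in> J"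
        unfolding J_def using cong uv by blast
      finally show ?thesis
        using J by simp
    qed
    have ex: "\<exists>u v. u \<noteq> 0 \<and> v \<noteq> 0 \<and> z = x + outer u v" if "z \<in> P s t \<or> z \<in> (+) x ` sector M J" for z
      using that unfolding P_def sph(3) by (auto simp: sector_def)
    show "P s t = (+) x ` sector M J"
      by (rule set_eqI) (metis mem ex)
  qed
  consider "i = 1" | "i = 6" | "i \<in> {2..5}"
    using i by fastforce
  then show thesis
  proof cases
    case 1
    show thesis
      by (rule that[of "{1}"]) (use 1 sph(1) part in \<open>simp_all add: M_def\<close>)
  next
    case 2
    show thesis
      by (rule that[of "{6}"]) (use 2 sph(2) part in \<open>simp_all add: M_def\<close>)
  next
    case 3
    then have "\<exists>s t. y_partition bilinear_adj q D N x y i = P s t"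
      unfolding part by (auto split: if_splits)
    then obtain J where "J \<subseteq> {2..5}" "y_partition bilinear_adj q D N x y i = (+) x ` sector M J"
      using P by metis
    then show thesis
      using 3 that[of J] by (auto simp: M_def)
  qed
qed

lemma y_partition_isometry:
  fixes \<phi> :: "'v::finite \<Rightarrow> 'v"
  assumes "bij \<phi>" and iso: "\<And>a b. graph_dist adj (\<phi> a) (\<phi> b) = graph_dist adj a b"
  shows "y_partition adj q D N (\<phi> x) (\<phi> y) i = \<phi> ` y_partition adj q D N x y i"
proof -
  have inj: "inj \<phi>"
    using assms(1) bij_is_inj by blast
  have sph: "sphere_at adj j (\<phi> a) = \<phi> ` sphere_at adj j a" for j a
  proof -
    have "\<phi> z \<in> sphere_at adj j (\<phi> a) \<longleftrightarrow> \<phi> z \<in> \<phi> ` sphere_at adj j a" for z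
      using inj iso by (auto simp: sphere_at_def inj_image_mem_iff)
    then show ?thesis
      using assms(1) by (metis bij_pointE subsetI subset_antisym)
  qed
  have Int: "\<phi> ` B \<inter> \<phi> ` C = \<phi> ` (B \<inter> C)" for B C
    using inj by (simp add: image_Int)
  have card: "card (\<phi> ` B) = card B" for B
    using inj inj_on_subset card_image by blast
  have filter: "{z \<in> \<phi> ` B. Q z} = \<phi> ` {z \<in> B. Q (\<phi> z)}" for B Q
    by auto
  show ?thesis
    unfolding y_partition_def Let_def iso sph Int filter card by simp
qed

section \<open>Fibre sums\<close>

text \<open>As \<open>p v* outer u v\<close> is \<open>(p \<cdot> u) *s v\<close>, a nonzero value
  \<open>c\<close> allows the free scalar to be spent on making \<open>p \<cdot> u = 1\<close>; then
  the second factor is \<open>c\<close> itself and only \<open>u\<close> is left to count.\<close>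

lemma card_sector_fibre:
  fixes M :: "'a::{field,finite}^'n^'m"
  assumes "c \<noteq> 0"
  shows "card {s \<in> sector M J. p v* s = c} = card {u. p \<cdot> u = 1 \<and> outer_type M u c \<in> J}"
proof (rule sym, rule bij_betw_same_card)
  show "bij_betw (\<lambda>u. outer u c) {u. p \<cdot> u = 1 \<and> outer_type M u c \<in> J} {s \<in> sector M J. p v* s = c}"
    unfolding bij_betw_def
  proof (intro conjI inj_onI subset_antisym subsetI)
    fix s assume "s \<in> (\<lambda>u. outer u c) ` {u. p \<cdot> u = 1 \<and> outer_type M u c \<in> J}"
    then obtain u where u: "s = outer u c" "p \<cdot> u = 1" "outer_type M u c \<in> J"
      by blast
    then have "u \<noteq> 0"
      by auto
    then show "s \<in> {s \<in> sector M J. p v* s = c}"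
      using u assms by (auto simp: outer_in_sector_iff)
  next
    fix s assume "s \<in> {s \<in> sector M J. p v* s = c}"
    then obtain a b where ab: "s = outer a b" "outer_type M a b \<in> J" "(p \<cdot> a) *s b = c"
      by (auto simp: sector_def)
    define t where "t = p \<cdot> a"
    have t: "t \<noteq> 0" "c = t *s b"
      using ab assms by (auto simp: t_def)
    have "s = outer (inverse t *s a) c"
      unfolding t(2) using ab(1) t(1) by (simp add: outer_linear)
    moreover have "outer_type M (inverse t *s a) c = outer_type M a b"
      unfolding t(2) using t(1) by (simp add: outer_type_scale)
    moreover have "p \<cdot> (inverse t *s a) = 1"
      using t(1) by (simp add: t_def)
    ultimately show "s \<in> (\<lambda>u. outer u c) ` {u. p \<cdot> u = 1 \<and> outer_type M u c \<in> J}"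
      using ab(2) by (intro image_eqI[of _ _ "inverse t *s a"]) auto
  qed (use assms in \<open>simp add: outer_cancel\<close>)
qed

text \<open>If \<open>p\<close> and \<open>r\<close> are independent as functionals on the column space of \<open>M\<close>, moving \<open>u\<close>
  along some \<open>u0\<close> with \<open>p \<cdot> u0 = 0\<close> and \<open>r \<cdot> u0 = 1\<close> turns \<open>r \<cdot> u\<close> into \<open>1 - r \<cdot> u\<close>. Otherwise \<open>c\<close> is
  a multiple of \<open>p v* M\<close> other than \<open>0\<close> and \<open>p v* M\<close>, and only types 3 and 5 occur on both sides.\<close>

lemma card_outer_type_reflect:
  fixes M :: "'a::{field,finite}^'n^'m"
  assumes c: "c \<noteq> 0" "c \<noteq> p v* M"
  shows "card {u. p \<cdot> u = 1 \<and> outer_type M u c \<in> J} = card {u. p \<cdot> u = 1 \<and> outer_type M u (p v* M - c) \<in> J}"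
proof (cases "c \<in> row_space M")
  case False
  have "p v* M \<in> row_space M"
    by (simp add: row_space_def)
  then have "p v* M - c \<notin> row_space M"
    using False vec.subspace_diff[OF subspace_row_space, of "p v* M" M "p v* M - c"] by auto
  then show ?thesis
    using False by (simp add: outer_type_def)
next
  case True
  then obtain r where r: "c = r v* M"
    by (auto simp: row_space_def)
  define d where "d = p v* M - c"
  have d: "d = (p - r) v* M"
    by (simp add: d_def r vector_matrix_mult_diff_distrib)
  have rows: "c \<in> row_space M" "d \<in> row_space M"
    by (simp_all add: r d row_space_def)
  have pc: "pairing M u c = r \<cdot> u" "pairing M u d = p \<cdot> u - r \<cdot> u" if "u \<in> col_space M" for u
    using pairing_vector_mult[OF that] by (simp_all add: r d)
  show ?thesis
    unfolding d_def[symmetric]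
  proof (cases "\<exists>u0\<in>col_space M. p \<cdot> u0 = 0 \<and> r \<cdot> u0 \<noteq> 0")
    case True
    then obtain u' where u': "u' \<in> col_space M" "p \<cdot> u' = 0" "r \<cdot> u' \<noteq> 0"
      by blast
    define u0 where "u0 = inverse (r \<cdot> u') *s u'"
    have u0: "u0 \<in> col_space M" "p \<cdot> u0 = 0" "r \<cdot> u0 = 1"
      using u' subspace_col_space vec.subspace_scale by (auto simp: u0_def)
    define \<psi> where "\<psi> u = u + (1 - 2 * (r \<cdot> u)) *s u0" for u
    have p\<psi>: "p \<cdot> \<psi> u = p \<cdot> u" and r\<psi>: "r \<cdot> \<psi> u = 1 - r \<cdot> u" for u
      using u0 by (simp_all add: \<psi>_def algebra_simps)
    have \<psi>\<psi>: "\<psi> (\<psi> u) = u" for u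
    proof -
      have "\<psi> (\<psi> u) = u + ((1 - 2 * (r \<cdot> u)) + (1 - 2 * (1 - r \<cdot> u))) *s u0"
        unfolding \<psi>_def[of "\<psi> u"] r\<psi> by (simp only: \<psi>_def vector_sadd_rdistrib add.assoc)
      then show ?thesis
        by (simp add: algebra_simps)
    qed
    have \<psi>_col: "\<psi> u \<in> col_space M" if "u \<in> col_space M" for u
      unfolding \<psi>_def using that u0(1) subspace_col_space vec.subspace_add vec.subspace_scale by blast
    have \<psi>_col_iff: "\<psi> u \<in> col_space M \<longleftrightarrow> u \<in> col_space M" for u
      using \<psi>_col[of u] \<psi>_col[of "\<psi> u"] by (auto simp: \<psi>\<psi>)
    \<comment> \<open>For \<open>p \<cdot> u = 1\<close> the pairings of \<open>u\<close> with
      \<open>c\<close> and with \<open>d\<close> add up to 1, so replacing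
      \<open>r \<cdot> u\<close> by its complement to 1 exchanges them.\<close>
    have type: "outer_type M (\<psi> u) d = outer_type M u c" "outer_type M (\<psi> u) c = outer_type M u d"
      if "p \<cdot> u = 1" for u
      using that rows by (auto simp: outer_type_def \<psi>_col_iff pc p\<psi> r\<psi>)
    show "card {u. p \<cdot> u = 1 \<and> outer_type M u c \<in> J} = card {u. p \<cdot> u = 1 \<and> outer_type M u d \<in> J}"
      by (rule bij_betw_same_card[OF bij_betw_byWitness[where f = \<psi> and f' = \<psi>]])
        (auto simp: \<psi>\<psi> type p\<psi>)
  next
    case False
    then have dep: "r \<cdot> u = 0" if "u \<in> col_space M" "p \<cdot> u = 0" for u
      using that by blast
    have "p \<notin> left_kernel M"
    proof
      assume "p \<in> left_kernel M"
      then have "r \<in> left_kernel M"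
        using dep by (intro dotp_vector_mult_eq_0) (auto simp: col_space_def)
      then show False
        using c r by (simp add: left_kernel_def)
    qed
    then obtain u1 where u1: "u1 \<in> col_space M" "p \<cdot> u1 = 1"
      using ex_col_space_dotp_eq_1 by blast
    define t where "t = r \<cdot> u1"
    have rt: "r \<cdot> u = t * (p \<cdot> u)" if "u \<in> col_space M" for u
    proof -
      have "u - (p \<cdot> u) *s u1 \<in> col_space M"
        using that u1(1) subspace_col_space vec.subspace_diff vec.subspace_scale by blast
      then have "r \<cdot> (u - (p \<cdot> u) *s u1) = 0"
        by (rule dep) (simp add: u1)
      then show ?thesis
        by (simp add: t_def mult.commute)
    qed
    then have "r - t *s p \<in> left_kernel M"
      by (intro dotp_vector_mult_eq_0) simp
    then have ct: "c = t *s (p v* M)"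
      by (simp add: left_kernel_def vector_matrix_mult_diff_distrib r)
    then have "t \<noteq> 0" "t \<noteq> 1"
      using c by auto
    then have "outer_type M u c = outer_type M u d" if "p \<cdot> u = 1" for u
      using that rows by (simp add: outer_type_def pc rt)
    then show "card {u. p \<cdot> u = 1 \<and> outer_type M u c \<in> J} = card {u. p \<cdot> u = 1 \<and> outer_type M u d \<in> J}"
      by (metis (mono_tags, lifting))
  qed
qed

section \<open>The gap between the fibres over 0 and over p M\<close>

lemma card_eq_sum_card_fibre:
  assumes "finite S" "finite B"
  shows "card {s \<in> S. h s \<in> B} = (\<Sum>b\<in>B. card {s \<in> S. h s = b})"
proof -
  have "card {s \<in> S. h s \<in> B} = (\<Sum>b\<in>B. card {s \<in> {s \<in> S. h s \<in> B}. h s = b})"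
    using sum.group[of "{s \<in> S. h s \<in> B}" B h "\<lambda>_. 1 :: nat"] assms by (simp add: image_subset_iff)
  also have "\<dots> = (\<Sum>b\<in>B. card {s \<in> S. h s = b})"
    by (intro sum.cong refl arg_cong[where f = card]) auto
  finally show ?thesis .
qed

text \<open>Every pairing value occurs equally often, so the count depends on \<open>J\<close> and
  on membership of \<open>u\<close> in the column space alone. The type of the excluded
  \<open>c = 0\<close> is determined by the same membership.\<close>

lemma card_outer_type_right_cong:
  fixes M :: "'a::{field,finite}^'n^'m"
  assumes u: "u \<noteq> 0" "u' \<noteq> 0" "u \<in> col_space M \<longleftrightarrow> u' \<in> col_space M"
  shows "card {c. c \<noteq> 0 \<and> outer_type M u c \<in> J} = card {c. c \<noteq> 0 \<and> outer_type M u' c \<in> J}"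
proof -
  have *: "card {c. outer_type M u c \<in> J} = card {c. outer_type M u' c \<in> J}"
  proof (cases "u \<in> col_space M")
    case False
    then show ?thesis
      using u by (simp add: outer_type_def)
  next
    case True
    define B where "B = {b :: 'a. (if b = 1 then 1 else if b = 0 then 2 else 3) \<in> J}"
    have "card {c. outer_type M a c \<in> J} =
        (\<Sum>b\<in>B. card (row_space M) div CARD('a)) + card {c. c \<notin> row_space M \<and> 4 \<in> J}"
      if a: "a \<in> col_space M" "a \<noteq> 0" for a
    proof -
      have "{c. outer_type M a c \<in> J} = {c \<in> row_space M. pairing M a c \<in> B} \<union> {c. c \<notin> row_space M \<and> 4 \<in> J}"
        using a by (auto simp: outer_type_def B_def)
      then have "card {c. outer_type M a c \<in> J} =
          card {c \<in> row_space M. pairing M a c \<in> B} + card {c. c \<notin> row_space M \<and> 4 \<in> J}"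
        by (simp add: card_Un_disjoint disjoint_iff)
      also have "card {c \<in> row_space M. pairing M a c \<in> B} =
          (\<Sum>b\<in>B. card {c \<in> row_space M. pairing M a c = b})"
        by (rule card_eq_sum_card_fibre) simp_all
      also have "\<dots> = (\<Sum>b\<in>B. card (row_space M) div CARD('a))"
      proof (rule sum.cong[OF refl])
        fix b
        show "card {c \<in> row_space M. pairing M a c = b} = card (row_space M) div CARD('a)"
          by (simp flip: card_pairing_fibre(2)[OF a, of b])
      qed
      finally show ?thesis .
    qed
    then show ?thesis
      using u True by simp
  qed
  have "{c. c \<noteq> 0 \<and> outer_type M a c \<in> J} = {c. outer_type M a c \<in> J} - {0}" for a
    by auto
  then show ?thesis
    using * u(3) outer_type_0(2)[of M u] outer_type_0(2)[of M u'] by (simp add: card_Diff_singleton_if)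
qed

text \<open>The coefficient lambda in disguise: the fibre sums vanish exactly when it equals this
  gap for all \<open>p\<close> outside the left kernel.\<close>

definition fibre_gap :: "'a::{field,finite}^'n^'m \<Rightarrow> nat set \<Rightarrow> 'a^'m \<Rightarrow> real" where
  "fibre_gap M J p = real (card {s \<in> sector M J. p v* s = 0}) - real (card {s \<in> sector M J. p v* s = p v* M})"

text \<open>The nonzero fibres together count pairs of \<open>u\<close> with
  \<open>p \<cdot> u = 1\<close> and a nonzero \<open>c\<close> of admissible type. For fixed
  \<open>u\<close> the number of such \<open>c\<close> depends only on whether \<open>u\<close> is
  in the column space, and the numbers of such \<open>u\<close> inside and outside it are the same
  for all \<open>p\<close> considered. The zero fibre is the complement.\<close>

lemma fibre_gap_const:
  fixes M :: "'a::{field,finite}^'n^'m"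
  assumes "p \<notin> left_kernel M" "p' \<notin> left_kernel M"
  shows "fibre_gap M J p = fibre_gap M J p'"
proof -
  obtain a where a: "a \<in> col_space M" "p \<cdot> a = 1"
    using ex_col_space_dotp_eq_1 assms(1) by blast
  \<comment> \<open>A representative of the outside. If the column space is everything,
    \<open>b\<close> is junk, but then \<open>outside p\<close> is empty.\<close>
  define b where "b = (SOME b. b \<notin> col_space M)"
  define inside where "inside p = {u. p \<cdot> u = 1 \<and> u \<in> col_space M}" for p
  define outside where "outside p = {u. p \<cdot> u = 1 \<and> u \<notin> col_space M}" for p
  have card_inside: "card (inside p) = card (col_space M) div CARD('a)"
    and card_outside: "card (outside p) = CARD('a) ^ CARD('m) div CARD('a) - card (col_space M) div CARD('a)"
    if p: "p \<notin> left_kernel M" for p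
  proof -
    obtain u where u: "u \<in> col_space M" "p \<cdot> u = 1"
      using ex_col_space_dotp_eq_1 p by blast
    have "CARD('a) * card {u \<in> col_space M. p \<cdot> u = 1} = card (col_space M)"
      by (rule card_fibre_linear[where ?g0.0 = u]) (use u in \<open>simp_all add: subspace_col_space\<close>)
    then show ins: "card (inside p) = card (col_space M) div CARD('a)"
      by (auto simp: inside_def conj_commute simp flip: \<open>_ = card (col_space M)\<close>)
    have "p \<noteq> 0"
      using u by auto
    then have "CARD('a) * card {u. p \<cdot> u = 1} = CARD('a) ^ CARD('m)"
      by (rule card_dotp_fibre)
    then have all: "card {u. p \<cdot> u = 1} = CARD('a) ^ CARD('m) div CARD('a)"
      by (metis nonzero_mult_div_cancel_left zero_less_card_finite less_numeral_extra(3))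
    have "outside p = {u. p \<cdot> u = 1} - inside p"
      by (auto simp: inside_def outside_def)
    then show "card (outside p) = CARD('a) ^ CARD('m) div CARD('a) - card (col_space M) div CARD('a)"
      using all ins by (simp add: card_Diff_subset inside_def Collect_mono_iff)
  qed
  have split: "{u. p \<cdot> u = 1 \<and> R u} = {u \<in> inside p. R u} \<union> {u \<in> outside p. R u}"
      "{u \<in> inside p. R u} \<inter> {u \<in> outside p. R u} = {}" for p R
    by (auto simp: inside_def outside_def)
  have nonzero_fibres: "(\<Sum>c\<in>- {0}. card {s \<in> sector M J. p v* s = c}) =
      card (inside p) * card {c. c \<noteq> 0 \<and> outer_type M a c \<in> J} +
      card (outside p) * card {c. c \<noteq> 0 \<and> outer_type M b c \<in> J}" for p
  proof -
    have "(\<Sum>c\<in>- {0}. card {s \<in> sector M J. p v* s = c}) =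
        (\<Sum>c\<in>- {0}. card {u \<in> {u. p \<cdot> u = 1}. outer_type M u c \<in> J})"
      by (intro sum.cong refl) (simp add: card_sector_fibre)
    also have "\<dots> = (\<Sum>u\<in>{u. p \<cdot> u = 1}. card {c \<in> - {0}. outer_type M u c \<in> J})"
      by (rule sum_multicount_gen) simp_all
    also have "\<dots> = (\<Sum>u\<in>inside p \<union> outside p. card {c. c \<noteq> 0 \<and> outer_type M u c \<in> J})"
      by (rule sum.cong) (auto simp: inside_def outside_def)
    also have "\<dots> = (\<Sum>u\<in>inside p. card {c. c \<noteq> 0 \<and> outer_type M u c \<in> J}) +
        (\<Sum>u\<in>outside p. card {c. c \<noteq> 0 \<and> outer_type M u c \<in> J})"
      by (rule sum.union_disjoint) (auto simp: inside_def outside_def)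
    also have "(\<Sum>u\<in>inside p. card {c. c \<noteq> 0 \<and> outer_type M u c \<in> J}) =
        (\<Sum>u\<in>inside p. card {c. c \<noteq> 0 \<and> outer_type M a c \<in> J})"
      by (intro sum.cong refl card_outer_type_right_cong) (use a in \<open>auto simp: inside_def\<close>)
    also have "(\<Sum>u\<in>outside p. card {c. c \<noteq> 0 \<and> outer_type M u c \<in> J}) =
        (\<Sum>u\<in>outside p. card {c. c \<noteq> 0 \<and> outer_type M b c \<in> J})"
    proof (intro sum.cong refl card_outer_type_right_cong)
      fix u assume "u \<in> outside p"
      then have u: "u \<notin> col_space M"
        by (simp add: outside_def)
      then have b: "b \<notin> col_space M"
        unfolding b_def by (rule someI)
      have "0 \<in> col_space M"
        using subspace_col_space vec.subspace_0 by blast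
      then show "u \<noteq> 0" "b \<noteq> 0" "u \<in> col_space M \<longleftrightarrow> b \<in> col_space M"
        using u b by auto
    qed
    finally show ?thesis
      by simp
  qed
  have zero_fibre: "real (card {s \<in> sector M J. p v* s = 0}) =
      real (card (sector M J)) - real (\<Sum>c\<in>- {0}. card {s \<in> sector M J. p v* s = c})" for p
  proof -
    have "card (sector M J) = (\<Sum>c\<in>UNIV. card {s \<in> sector M J. p v* s = c})"
      using card_eq_sum_card_fibre[of "sector M J" UNIV "\<lambda>s. p v* s"] by simp
    also have "\<dots> = card {s \<in> sector M J. p v* s = 0} + (\<Sum>c\<in>- {0}. card {s \<in> sector M J. p v* s = c})"
      by (subst sum.remove[of _ 0]) (simp_all add: Compl_eq_Diff_UNIV)
    finally show ?thesis
      by simp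
  qed
  have image_fibre: "card {s \<in> sector M J. p v* s = p v* M} =
      (if 1 \<in> J then card (inside p) else 0) + (if 5 \<in> J then card (outside p) else 0)"
    if p: "p \<notin> left_kernel M" for p
  proof -
    have "p v* M \<noteq> 0"
      using p by (simp add: left_kernel_def)
    then have "card {s \<in> sector M J. p v* s = p v* M} = card {u. p \<cdot> u = 1 \<and> outer_type M u (p v* M) \<in> J}"
      by (rule card_sector_fibre)
    also have "\<dots> = card {u \<in> inside p. outer_type M u (p v* M) \<in> J} + card {u \<in> outside p. outer_type M u (p v* M) \<in> J}"
      unfolding split(1) by (rule card_Un_disjoint) (simp_all add: split(2))
    \<comment> \<open>Inside the column space the pairing of \<open>u\<close> with
      \<open>p v* M\<close> is \<open>p \<cdot> u = 1\<close>, so the type is always 1; outside it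
      is always 5.\<close>
    also have "{u \<in> inside p. outer_type M u (p v* M) \<in> J} = (if 1 \<in> J then inside p else {})"
      by (auto simp: inside_def outer_type_def row_space_def pairing_vector_mult)
    also have "{u \<in> outside p. outer_type M u (p v* M) \<in> J} = (if 5 \<in> J then outside p else {})"
      by (auto simp: outside_def outer_type_def row_space_def)
    finally show ?thesis
      by simp
  qed
  show ?thesis
    unfolding fibre_gap_def zero_fibre nonzero_fibres image_fibre[OF assms(1)] image_fibre[OF assms(2)]
      card_inside[OF assms(1)] card_inside[OF assms(2)] card_outside[OF assms(1)] card_outside[OF assms(2)]
    ..
qed

text \<open>The common value of \<open>fibre_gap\<close> off the left kernel is found by summing over all \<open>p\<close>.\<close>

lemma fibre_gap_eq:
  fixes M :: "'a::{field,finite}^'n^'m"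
  assumes p: "p \<notin> left_kernel M"
    and m: "\<And>s. s \<in> sector M J \<Longrightarrow> real (card (left_kernel (M - s))) = m"
  shows "fibre_gap M J p * (real CARD('a) ^ CARD('m) - real (card (left_kernel M))) =
    real (card (sector M J)) * (real CARD('a) ^ CARD('m) / real CARD('a) - m)"
proof -
  have "(\<Sum>p'\<in>UNIV. card {s \<in> sector M J. p' v* s = 0}) = (\<Sum>s\<in>sector M J. card {p' \<in> UNIV. p' v* s = 0})"
    by (rule sum_multicount_gen) simp_all
  also have "real \<dots> = (\<Sum>s\<in>sector M J. real CARD('a) ^ CARD('m) / real CARD('a))"
    unfolding of_nat_sum
  proof (rule sum.cong[OF refl])
    fix s assume "s \<in> sector M J"
    then obtain u v where "u \<noteq> 0" "{p'. p' v* s = 0} = {p'. p' \<cdot> u = 0}"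
      by (auto simp: sector_def)
    then have "CARD('a) * card {p'. p' v* s = 0} = CARD('a) ^ CARD('m)"
      using card_dotp_fibre(1)[of u 0] by simp
    then have "real CARD('a) * real (card {p'. p' v* s = 0}) = real CARD('a) ^ CARD('m)"
      by (metis of_nat_mult of_nat_power)
    then show "real (card {p' \<in> UNIV. p' v* s = 0}) = real CARD('a) ^ CARD('m) / real CARD('a)"
      by (simp add: field_simps)
  qed
  finally have 1: "real (\<Sum>p'\<in>UNIV. card {s \<in> sector M J. p' v* s = 0}) =
    real (card (sector M J)) * (real CARD('a) ^ CARD('m) / real CARD('a))"
    by simp
  have "(\<Sum>p'\<in>UNIV. card {s \<in> sector M J. p' v* s = p' v* M}) =
      (\<Sum>s\<in>sector M J. card {p' \<in> UNIV. p' v* s = p' v* M})"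
    by (rule sum_multicount_gen) simp_all
  also have "real \<dots> = (\<Sum>s\<in>sector M J. m)"
    unfolding of_nat_sum
  proof (rule sum.cong[OF refl])
    fix s assume s: "s \<in> sector M J"
    \<comment> \<open>Here the rank of \<open>M - s\<close>, that is, the distance from y to x + s,
      enters the coefficient.\<close>
    have "{p' \<in> UNIV. p' v* s = p' v* M} = left_kernel (M - s)"
      by (auto simp: left_kernel_def vector_matrix_mult_diff_rdistrib)
    then show "real (card {p' \<in> UNIV. p' v* s = p' v* M}) = m"
      using m[OF s] by simp
  qed
  finally have 2: "real (\<Sum>p'\<in>UNIV. card {s \<in> sector M J. p' v* s = p' v* M}) = real (card (sector M J)) * m"
    by simp
  have "real (card (sector M J)) * (real CARD('a) ^ CARD('m) / real CARD('a) - m) =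
      (\<Sum>p'\<in>UNIV. fibre_gap M J p')"
    using 1 2 by (simp add: fibre_gap_def sum_subtractf right_diff_distrib)
  also have "\<dots> = (\<Sum>p'\<in>- left_kernel M. fibre_gap M J p')"
    by (rule sum.mono_neutral_right) (auto simp: fibre_gap_def left_kernel_def)
  also have "\<dots> = (\<Sum>p'\<in>- left_kernel M. fibre_gap M J p)"
    by (intro sum.cong refl fibre_gap_const p) simp
  also have "\<dots> = real (card (- left_kernel M)) * fibre_gap M J p"
    by simp
  also have "real (card (- left_kernel M)) = real CARD('a) ^ CARD('m) - real (card (left_kernel M))"
  proof -
    have "card (left_kernel M) \<le> CARD('a^'m)"
      by (rule card_mono) simp_all
    then show ?thesis
      by (simp add: Compl_eq_Diff_UNIV card_Diff_subset of_nat_diff)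
  qed
  finally show ?thesis
    by (simp add: mult.commute)
qed

section \<open>Vanishing of the fibre sums\<close>

lemma hat_set_nth: "hat_set \<Omega> $ z = (if z \<in> \<Omega> then 1 else 0)" for z :: "'v::finite"
  by (simp add: hat_set_def hat_def axis_def sum.delta)

lemma sum_hat_set: "(\<Sum>z\<in>F. hat_set \<Omega> $ z) = real (card (\<Omega> \<inter> F))" for F :: "'v::finite set"
  by (simp add: hat_set_nth sum.If_cases Int_commute)

text \<open>With \<open>e = c - p v* x\<close>, the vertices x + s contribute n(e) and the vertices
  y - s contribute n(p M - e), while x and y are met only for e = 0 and e = p M. So the sum is zero
  by reflection for other \<open>e\<close> and by the choice of \<open>l\<close> at these two; if p
  M = 0, the two coincide and all terms cancel.\<close>

lemma sum_fibre_eq_0: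
  fixes x y :: "'a::{field,finite}^'n^'m"
  assumes "x \<noteq> y"
    and m: "\<And>s. s \<in> sector (y - x) J \<Longrightarrow> real (card (left_kernel (y - x - s))) = m"
    and l: "l * (real CARD('a) ^ CARD('m) - real (card (left_kernel (y - x)))) =
      real (card (sector (y - x) J)) * (real CARD('a) ^ CARD('m) / real CARD('a) - m)"
    and w: "w = hat_set ((+) x ` sector (y - x) J) - hat_set ((-) y ` sector (y - x) J) - l *\<^sub>R (hat x - hat y)"
  shows "(\<Sum>z | p v* z = c. w $ z) = 0"
proof -
  define M where "M = y - x"
  define S where "S = sector M J"
  define N where "N e = real (card {s \<in> S. p v* s = e})" for e
  define e where "e = c - p v* x"
  have y: "y = x + M"
    by (simp add: M_def)
  have hat: "hat z = hat_set {z}" for z :: "'a^'n^'m"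
    by (simp add: hat_set_def)
  have "card ((+) x ` S \<inter> {z. p v* z = c}) = card {s \<in> S. p v* s = e}"
  proof -
    have "(+) x ` S \<inter> {z. p v* z = c} = (+) x ` {s \<in> S. p v* s = e}"
      by (auto simp: e_def vector_matrix_mult_add_rdistrib)
    then show ?thesis
      by (simp add: card_image)
  qed
  moreover have "card ((-) y ` S \<inter> {z. p v* z = c}) = card {s \<in> S. p v* s = p v* M - e}"
  proof -
    have "p v* (y - s) = c \<longleftrightarrow> p v* s = p v* M - e" for s
      by (auto simp: y e_def vector_matrix_mult_add_rdistrib vector_matrix_mult_diff_rdistrib algebra_simps)
    then have "(-) y ` S \<inter> {z. p v* z = c} = (-) y ` {s \<in> S. p v* s = p v* M - e}"
      by auto
    then show ?thesis
      by (simp add: card_image)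
  qed
  moreover have "(\<Sum>z | p v* z = c. hat x $ z) = (if e = 0 then 1 else 0)"
    unfolding hat sum_hat_set by (auto simp: e_def)
  moreover have "(\<Sum>z | p v* z = c. hat y $ z) = (if e = p v* M then 1 else 0)"
  proof -
    have "{y} \<inter> {z. p v* z = c} = (if e = p v* M then {y} else {})"
      by (auto simp: e_def y vector_matrix_mult_add_rdistrib algebra_simps)
    then show ?thesis
      unfolding hat sum_hat_set by simp
  qed
  ultimately have sum: "(\<Sum>z | p v* z = c. w $ z) =
      N e - N (p v* M - e) - l * ((if e = 0 then 1 else 0) - (if e = p v* M then 1 else 0))"
    unfolding w M_def[symmetric] S_def[symmetric]
    by (simp add: sum_subtractf sum_hat_set N_def flip: sum_distrib_left)
  have gap: "N 0 - N (p v* M) = l" if "p v* M \<noteq> 0"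
  proof -
    have p: "p \<notin> left_kernel M"
      using that by (simp add: left_kernel_def)
    then have "left_kernel M \<noteq> UNIV"
      by auto
    then have "card (left_kernel M) < CARD('a^'m)"
      by (intro psubset_card_mono psubsetI) simp_all
    then have "real (card (left_kernel M)) < real (CARD('a) ^ CARD('m))"
      by (metis CARD_vec of_nat_less_iff)
    moreover have "fibre_gap M J p * (real CARD('a) ^ CARD('m) - real (card (left_kernel M))) =
        l * (real CARD('a) ^ CARD('m) - real (card (left_kernel M)))"
      using fibre_gap_eq[OF p, of J m] m l by (simp add: M_def)
    ultimately show ?thesis
      by (simp add: fibre_gap_def N_def S_def)
  qed
  show ?thesis
  proof (cases "e = 0 \<or> e = p v* M")
    case True
    then show ?thesis
      unfolding sum using gap by (cases "p v* M = 0") auto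
  next
    case False
    then have "N e = N (p v* M - e)"
      unfolding N_def S_def using card_sector_fibre[of e M J p] card_sector_fibre[of "p v* M - e" M J p]
        card_outer_type_reflect[of e p M J] by auto
    then show ?thesis
      unfolding sum using False by simp
  qed
qed

section \<open>The spectrum of the bilinear forms graph\<close>

text \<open>Each projection splits \<open>g\<close> into \<open>P i g\<close> and
  \<open>g - P i g\<close>, and commutation keeps both parts joint eigenvectors of the projections
  already treated. The invariant subspace \<open>Q\<close> allows two uses: for an eigenspace of the
  adjacency matrix and for the functions with vanishing fibre sums.\<close>

lemma in_span_joint_eigenvectors:
  fixes P :: "'i \<Rightarrow> 'v::real_vector \<Rightarrow> 'v"
  assumes "finite F" and lin: "\<And>i. linear (P i)" and idem: "\<And>i f. P i (P i f) = P i f"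
    and comm: "\<And>i j f. P i (P j f) = P j (P i f)"
    and Q: "subspace Q" "\<And>i f. f \<in> Q \<Longrightarrow> P i f \<in> Q"
    and "f \<in> Q"
  shows "f \<in> span {g \<in> Q. \<forall>i\<in>F. P i g = g \<or> P i g = 0}"
  using \<open>finite F\<close>
proof (induction F)
  case empty
  then show ?case
    using \<open>f \<in> Q\<close> by (simp add: span_base)
next
  case (insert i F)
  let ?J = "\<lambda>F. {g \<in> Q. \<forall>i\<in>F. P i g = g \<or> P i g = 0}"
  have "?J F \<subseteq> span (?J (insert i F))"
  proof
    fix g assume g: "g \<in> ?J F"
    have "P j (P i g) = P i g \<or> P j (P i g) = 0" if "j \<in> F" for j
      using g that comm[of j i g] linear_0[OF lin[of i]] by force
    then have 1: "P i g \<in> ?J (insert i F)"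
      using g Q(2) idem by auto
    have "P j (g - P i g) = g - P i g \<or> P j (g - P i g) = 0" if "j \<in> F" for j
      using g that comm[of j i g] linear_0[OF lin[of i]] linear_diff[OF lin[of j], of g "P i g"] by force
    then have 2: "g - P i g \<in> ?J (insert i F)"
      using g Q(2) subspace_diff[OF Q(1)] idem linear_diff[OF lin[of i], of g "P i g"] by auto
    have "P i g + (g - P i g) \<in> span (?J (insert i F))"
      by (intro span_add span_base 1 2)
    then show "g \<in> span (?J (insert i F))"
      by simp
  qed
  then have "span (?J F) \<subseteq> span (?J (insert i F))"
    by (simp add: span_minimal)
  then show ?case
    using insert.IH by blast
qed

section \<open>Shift averages and the adjacency matrix\<close>

definition shift_avg :: "'a::{field,finite}^'m \<Rightarrow> real^('a^'n^'m) \<Rightarrow> real^('a^'n^'m)" where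
  "shift_avg u f = (\<chi> z. (\<Sum>v\<in>UNIV. f $ (z + outer u v)) / real CARD('a) ^ CARD('n))"

lemma shift_avg_nth:
  "shift_avg u (f :: real^('a::{field,finite}^'n^'m)) $ z =
    (\<Sum>v\<in>UNIV. f $ (z + outer u v)) / real CARD('a) ^ CARD('n)"
  by (simp add: shift_avg_def)

lemma linear_shift_avg: "linear (shift_avg u)"
  by (rule linearI)
    (simp_all add: vec_eq_iff shift_avg_nth sum.distrib add_divide_distrib flip: sum_distrib_left)

lemma shift_avg_invariant: "shift_avg u f $ (z + outer u w) = shift_avg u f $ z"
proof -
  have "(\<Sum>v\<in>UNIV. f $ (z + outer u w + outer u v)) = (\<Sum>v\<in>UNIV. f $ (z + outer u v))"
    by (rule sum.reindex_bij_witness[of _ "\<lambda>v. v - w" "\<lambda>v. v + w"]) (simp_all add: outer_linear algebra_simps)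
  then show ?thesis
    by (simp add: shift_avg_nth)
qed

lemma shift_avg_fixed_iff: "shift_avg u f = f \<longleftrightarrow> (\<forall>z v. f $ (z + outer u v) = f $ z)"
proof
  assume "shift_avg u f = f"
  then show "\<forall>z v. f $ (z + outer u v) = f $ z"
    using shift_avg_invariant[of u f] by simp
next
  assume "\<forall>z v. f $ (z + outer u v) = f $ z"
  then show "shift_avg u f = f"
    by (simp add: vec_eq_iff shift_avg_nth)
qed

lemma shift_avg_idem: "shift_avg u (shift_avg u f) = shift_avg u f"
  by (simp add: shift_avg_fixed_iff shift_avg_invariant)

lemma shift_avg_commute: "shift_avg u (shift_avg u' f) = shift_avg u' (shift_avg u f)"
proof -
  have "(\<Sum>v\<in>UNIV. \<Sum>v'\<in>UNIV. f $ (z + outer u v + outer u' v')) =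
      (\<Sum>v'\<in>UNIV. \<Sum>v\<in>UNIV. f $ (z + outer u' v' + outer u v))" for z
    by (subst sum.swap) (simp add: add_ac)
  then show ?thesis
    by (simp add: vec_eq_iff shift_avg_nth flip: sum_divide_distrib)
qed

text \<open>Each matrix of rank one is \<open>outer u v\<close> for exactly q - 1 pairs. The q^D +
  q^(N-D) - 1 pairs with a zero factor do not move \<open>z\<close>.\<close>

lemma sum_shift_outer:
  fixes f :: "real^('a::{field,finite}^'n^'m)"
  shows "(\<Sum>u\<in>UNIV. \<Sum>v\<in>UNIV. f $ (z + outer u v)) =
    (real CARD('a) - 1) * (\<Sum>w | bilinear_adj z w. f $ w) +
    (real CARD('a) ^ CARD('m) + real CARD('a) ^ CARD('n) - 1) * f $ z"
proof -
  define NZ :: "(('a^'m) \<times> ('a^'n)) set" where "NZ = (- {0}) \<times> (- {0})"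
  define h :: "('a^'m) \<times> ('a^'n) \<Rightarrow> 'a^'n^'m" where "h = (\<lambda>(u, v). z + outer u v)"
  have fibre: "card {t \<in> NZ. h t = w} = CARD('a) - 1" if w: "bilinear_adj z w" for w
  proof -
    obtain u v where uv: "u \<noteq> 0" "v \<noteq> 0" "w = z + outer u v"
      using w by (auto simp: bilinear_adj_iff)
    have "bij_betw (\<lambda>c. (inverse c *s u, c *s v)) (- {0}) {t \<in> NZ. h t = w}"
      unfolding bij_betw_def
    proof (intro conjI inj_onI subset_antisym subsetI)
      fix c d assume "(inverse c *s u, c *s v) = (inverse d *s u, d *s v)"
      then show "c = d"
        using uv by simp
    next
      fix t assume "t \<in> (\<lambda>c. (inverse c *s u, c *s v)) ` (- {0})"
      then show "t \<in> {t \<in> NZ. h t = w}"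
        using uv by (auto simp: NZ_def h_def outer_linear)
    next
      fix t assume t: "t \<in> {t \<in> NZ. h t = w}"
      obtain a b where ab: "t = (a, b)"
        by (cases t)
      then have "outer u v = outer a b"
        using t uv by (simp add: h_def)
      then obtain c where c: "c \<noteq> 0" "u = c *s a" "b = c *s v"
        using outer_eq_iff uv by metis
      then show "t \<in> (\<lambda>c. (inverse c *s u, c *s v)) ` (- {0})"
        by (intro image_eqI[of _ _ c]) (simp_all add: ab)
    qed
    then have "card (- {0 :: 'a}) = card {t \<in> NZ. h t = w}"
      by (rule bij_betw_same_card)
    then show ?thesis
      by (simp add: Compl_eq_Diff_UNIV card_Diff_singleton)
  qed
  have "(\<Sum>u\<in>UNIV. \<Sum>v\<in>UNIV. f $ (z + outer u v)) = (\<Sum>t\<in>UNIV. f $ h t)"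
    unfolding h_def UNIV_Times_UNIV[symmetric] sum.cartesian_product by (simp add: case_prod_unfold)
  also have "\<dots> = (\<Sum>t\<in>NZ. f $ h t) + (\<Sum>t\<in>- NZ. f $ h t)"
    by (subst sum.union_disjoint[symmetric]) simp_all
  also have "(\<Sum>t\<in>- NZ. f $ h t) = (\<Sum>t\<in>- NZ. f $ z)"
    by (rule sum.cong[OF refl]) (auto simp: NZ_def h_def outer_linear)
  also have "\<dots> = (real CARD('a) ^ CARD('m) + real CARD('a) ^ CARD('n) - 1) * f $ z"
  proof -
    have pos: "1 \<le> CARD('a) ^ CARD('m)" "1 \<le> CARD('a) ^ CARD('n)"
      by (simp_all add: Suc_leI)
    have "card NZ = (CARD('a) ^ CARD('m) - 1) * (CARD('a) ^ CARD('n) - 1)"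
      by (simp add: NZ_def card_cartesian_product Compl_eq_Diff_UNIV card_Diff_singleton)
    then have "real (card NZ) = (real CARD('a) ^ CARD('m) - 1) * (real CARD('a) ^ CARD('n) - 1)"
      using pos by (simp add: of_nat_diff)
    moreover have "real (card (- NZ)) = real CARD('a) ^ CARD('m) * real CARD('a) ^ CARD('n) - real (card NZ)"
    proof -
      have "card NZ \<le> CARD(('a^'m) \<times> ('a^'n))"
        by (rule card_mono) simp_all
      then show ?thesis
        by (simp add: Compl_eq_Diff_UNIV card_Diff_subset of_nat_diff)
    qed
    ultimately have "real (card (- NZ)) = real CARD('a) ^ CARD('m) + real CARD('a) ^ CARD('n) - 1"
      by (simp add: algebra_simps)
    then show ?thesis
      by simp
  qed
  also have "(\<Sum>t\<in>NZ. f $ h t) = (\<Sum>w | bilinear_adj z w. \<Sum>t | t \<in> NZ \<and> h t = w. f $ h t)"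
    by (rule sum.group[symmetric]) (auto simp: NZ_def h_def bilinear_adj_iff)
  also have "\<dots> = (\<Sum>w | bilinear_adj z w. real (CARD('a) - 1) * f $ w)"
    by (rule sum.cong[OF refl]) (simp add: fibre)
  also have "\<dots> = (real CARD('a) - 1) * (\<Sum>w | bilinear_adj z w. f $ w)"
    by (simp add: of_nat_diff Suc_leI flip: sum_distrib_left)
  finally show ?thesis .
qed

definition bilinear_matrix :: "real^('a::{field,finite}^'n^'m)^('a^'n^'m)" where
  "bilinear_matrix = adjacency_matrix bilinear_adj"

lemma bilinear_matrix_mult:
  fixes f :: "real^('a::{field,finite}^'n^'m)"
  shows "(real CARD('a) - 1) *\<^sub>R (bilinear_matrix *v f) =
    real CARD('a) ^ CARD('n) *\<^sub>R (\<Sum>u\<in>UNIV. shift_avg u f) -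
    (real CARD('a) ^ CARD('m) + real CARD('a) ^ CARD('n) - 1) *\<^sub>R f"
proof -
  have "(bilinear_matrix *v f) $ z = (\<Sum>w | bilinear_adj z w. f $ w)" for z
    by (simp add: bilinear_matrix_def adjacency_matrix_def matrix_vector_mult_def if_distrib if_distribR
      sum.If_cases cong: if_cong)
  moreover have "real CARD('a) ^ CARD('n) * (\<Sum>u\<in>UNIV. shift_avg u f $ z) =
      (\<Sum>u\<in>UNIV. \<Sum>v\<in>UNIV. f $ (z + outer u v))" for z
    by (simp add: shift_avg_nth flip: sum_divide_distrib)
  ultimately show ?thesis
    by (simp add: vec_eq_iff sum_shift_outer)
qed

lemma bilinear_matrix_shift_avg_commute:
  fixes f :: "real^('a::{field,finite}^'n^'m)"
  shows "bilinear_matrix *v shift_avg u f = shift_avg u (bilinear_matrix *v f)"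
proof -
  note lin = linear_shift_avg[of u]
  have "(real CARD('a) - 1) *\<^sub>R (bilinear_matrix *v shift_avg u f) =
      shift_avg u ((real CARD('a) - 1) *\<^sub>R (bilinear_matrix *v f))"
    unfolding bilinear_matrix_mult
    by (simp add: linear_diff[OF lin] linear_cmul[OF lin] linear_sum[OF lin] shift_avg_commute[of u])
  then show ?thesis
    using field_card_gt_1[where 'a = 'a] by (simp add: linear_cmul[OF lin])
qed

section \<open>Eigenvalues in terms of stabilizers\<close>

definition stabilizer :: "real^('a::{field,finite}^'n^'m) \<Rightarrow> ('a^'m) set" where
  "stabilizer g = {u. shift_avg u g = g}"

definition joint_eigenvector :: "real^('a::{field,finite}^'n^'m) \<Rightarrow> bool" where
  "joint_eigenvector g \<longleftrightarrow> (\<forall>u. shift_avg u g = g \<or> shift_avg u g = 0)"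

lemma subspace_stabilizer: "vec.subspace (stabilizer g)"
  unfolding vec.subspace_def stabilizer_def mem_Collect_eq shift_avg_fixed_iff
proof (intro conjI allI ballI impI)
  fix u u' z v
  assume "u \<in> {u. \<forall>z v. g $ (z + outer u v) = g $ z}" "u' \<in> {u. \<forall>z v. g $ (z + outer u v) = g $ z}"
  then show "g $ (z + outer (u + u') v) = g $ z"
    by (simp add: outer_linear flip: add.assoc)
next
  fix c u z v
  assume "u \<in> {u. \<forall>z v. g $ (z + outer u v) = g $ z}"
  then show "g $ (z + outer (c *s u) v) = g $ z"
    by (simp flip: outer_linear(9))
qed (simp add: outer_linear)

text \<open>For \<open>t\<close> = q^(D-i) this is theta_i. The type arguments carry q, N - D and D,
  and the value increases strictly with \<open>t\<close>.\<close>

definition bilinear_eigenvalue :: "'a::{field,finite} itself \<Rightarrow> 'n itself \<Rightarrow> 'm itself \<Rightarrow> real \<Rightarrow> real" where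
  "bilinear_eigenvalue _ _ _ t =
    (real CARD('a) ^ CARD('n) * t - (real CARD('a) ^ CARD('m) + real CARD('a) ^ CARD('n) - 1)) / (real CARD('a) - 1)"

lemma bilinear_matrix_joint_eigenvector:
  fixes g :: "real^('a::{field,finite}^'n^'m)"
  assumes "joint_eigenvector g"
  shows "bilinear_matrix *v g =
    bilinear_eigenvalue TYPE('a) TYPE('n) TYPE('m) (real (card (stabilizer g))) *\<^sub>R g"
proof -
  have "(\<Sum>u\<in>UNIV. shift_avg u g) = (\<Sum>u\<in>stabilizer g. g)"
    by (rule sum.mono_neutral_cong_right) (use assms in \<open>auto simp: stabilizer_def joint_eigenvector_def\<close>)
  then have "(\<Sum>u\<in>UNIV. shift_avg u g) = real (card (stabilizer g)) *\<^sub>R g"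
    by (simp only: sum_constant_scaleR)
  then have scaled: "(real CARD('a) - 1) *\<^sub>R (bilinear_matrix *v g) =
      (real CARD('a) ^ CARD('n) * real (card (stabilizer g)) -
        (real CARD('a) ^ CARD('m) + real CARD('a) ^ CARD('n) - 1)) *\<^sub>R g"
    unfolding bilinear_matrix_mult by (simp add: scaleR_diff_left)
  have "inverse (real CARD('a) - 1) *\<^sub>R ((real CARD('a) - 1) *\<^sub>R (bilinear_matrix *v g)) =
      bilinear_eigenvalue TYPE('a) TYPE('n) TYPE('m) (real (card (stabilizer g))) *\<^sub>R g"
    unfolding scaled scaleR_scaleR bilinear_eigenvalue_def divide_inverse by (simp only: mult.commute)
  then show ?thesis
    using field_card_gt_1[where 'a = 'a] by simp
qed

lemma bilinear_eigenvalue_le_iff: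
  "bilinear_eigenvalue TYPE('a::{field,finite}) TYPE('n) TYPE('m) s \<le>
    bilinear_eigenvalue TYPE('a::{field,finite}) TYPE('n) TYPE('m) t \<longleftrightarrow> s \<le> t"
  using field_card_gt_1[where 'a = 'a] by (simp add: bilinear_eigenvalue_def divide_le_cancel)

lemma bilinear_eigenvalue_eq_iff:
  "bilinear_eigenvalue TYPE('a::{field,finite}) TYPE('n) TYPE('m) s =
    bilinear_eigenvalue TYPE('a::{field,finite}) TYPE('n) TYPE('m) t \<longleftrightarrow> s = t"
  by (metis bilinear_eigenvalue_le_iff order_antisym order_refl)

lemma in_span_joint_eigenvector:
  assumes "subspace Q" "\<And>u f. f \<in> Q \<Longrightarrow> shift_avg u f \<in> Q" "f \<in> Q"
  shows "f \<in> span {g \<in> Q. joint_eigenvector g}"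
  using in_span_joint_eigenvectors[of UNIV shift_avg Q f, OF finite_class.finite_UNIV linear_shift_avg
      shift_avg_idem shift_avg_commute assms]
  by (simp add: joint_eigenvector_def)

text \<open>Shift averages commute with the adjacency matrix, so the eigenspace is invariant under
  them and is spanned by joint eigenvectors; one of these is nonzero.\<close>

lemma eigenvalue_obtains_stabilizer:
  fixes \<mu> :: real
  assumes "\<mu> \<in> eigenvalues (bilinear_matrix :: real^('a::{field,finite}^'n^'m)^('a^'n^'m))"
  obtains g :: "real^('a::{field,finite}^'n^'m)" where "g \<noteq> 0" "joint_eigenvector g"
    "\<mu> = bilinear_eigenvalue TYPE('a) TYPE('n) TYPE('m) (real (card (stabilizer g)))"
proof -
  obtain f :: "real^('a^'n^'m)" where f: "bilinear_matrix *v f = \<mu> *\<^sub>R f" "f \<noteq> 0"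
    using assms by (auto simp: eigenvalues_def eigenspace_def)
  define Q where "Q = eigenspace (bilinear_matrix :: real^('a^'n^'m)^('a^'n^'m)) \<mu>"
  have Q: "subspace Q"
    by (auto simp: Q_def eigenspace_def subspace_def matrix_vector_right_distrib scaleR_add_right
        matrix_vector_mult_scaleR mult.commute)
  have "shift_avg u h \<in> Q" if "h \<in> Q" for u h
    using that by (simp add: Q_def eigenspace_def bilinear_matrix_shift_avg_commute
        linear_cmul[OF linear_shift_avg])
  then have "f \<in> span {g \<in> Q. joint_eigenvector g}"
    using Q f by (intro in_span_joint_eigenvector) (simp_all add: Q_def eigenspace_def)
  moreover have "span {g \<in> Q. joint_eigenvector g} \<subseteq> {0}" if "{g \<in> Q. joint_eigenvector g} \<subseteq> {0}"
    using that by (rule span_minimal) (rule subspace_single_0)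
  ultimately obtain g where g: "g \<in> Q" "joint_eigenvector g" "g \<noteq> 0"
    using f(2) by blast
  then have "\<mu> *\<^sub>R g = bilinear_eigenvalue TYPE('a) TYPE('n) TYPE('m) (real (card (stabilizer g))) *\<^sub>R g"
    using bilinear_matrix_joint_eigenvector[OF g(2)] by (simp add: Q_def eigenspace_def)
  then show thesis
    using that g by auto
qed

lemma joint_eigenvector_in_eigenvalues:
  fixes g :: "real^('a::{field,finite}^'n^'m)"
  assumes "joint_eigenvector g" "g \<noteq> 0"
  shows "bilinear_eigenvalue TYPE('a) TYPE('n) TYPE('m) (real (card (stabilizer g))) \<in>
    eigenvalues (bilinear_matrix :: real^('a^'n^'m)^('a^'n^'m))"
  using bilinear_matrix_joint_eigenvector[OF assms(1)] assms(2)
  by (auto simp: eigenvalues_def eigenspace_def)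

lemma card_proper_subspace_le:
  fixes T :: "('a::{field,finite}^'m) set"
  assumes "vec.subspace T" "T \<noteq> UNIV"
  shows "real (card T) \<le> real CARD('a) ^ CARD('m) / real CARD('a)"
    and "real (card T) = real CARD('a) ^ CARD('m) / real CARD('a) \<Longrightarrow> \<exists>p. p \<noteq> 0 \<and> T = {u. p \<cdot> u = 0}"
proof -
  obtain p where p: "p \<noteq> 0" "T \<subseteq> {u. p \<cdot> u = 0}"
    using ex_annihilator[OF assms] by blast
  have "CARD('a) * card {u. p \<cdot> u = 0} = CARD('a) ^ CARD('m)"
    using card_dotp_fibre(2)[OF p(1)] .
  then have "real CARD('a) * real (card {u. p \<cdot> u = 0}) = real CARD('a) ^ CARD('m)"
    by (metis of_nat_mult of_nat_power)
  then have c: "real (card {u. p \<cdot> u = 0}) = real CARD('a) ^ CARD('m) / real CARD('a)"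
    by (simp add: field_simps)
  show "real (card T) \<le> real CARD('a) ^ CARD('m) / real CARD('a)"
    using card_mono[OF _ p(2)] by (simp flip: c)
  show "\<exists>p. p \<noteq> 0 \<and> T = {u. p \<cdot> u = 0}" if "real (card T) = real CARD('a) ^ CARD('m) / real CARD('a)"
    using card_subset_eq[OF _ p(2)] that p(1) by (auto simp flip: c)
qed

text \<open>This shows that the hyperplane value is attained as an eigenvalue. The function compares
  two values of \<open>p v* z\<close>: shifts with \<open>p \<cdot> u = 0\<close> do not change it,
  and otherwise \<open>p v* z\<close> runs once through all row vectors, so that the average is 1 -
  1.\<close>

lemma ex_joint_eigenvector_hyperplane:
  fixes p :: "'a::{field,finite}^'m"
  assumes "p \<noteq> 0"
  obtains g :: "real^('a^'n^'m)" where "g \<noteq> 0" "joint_eigenvector g" "stabilizer g = {u. p \<cdot> u = 0}"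
proof -
  define e :: "'a^'n" where "e = (\<chi> j. 1)"
  have e: "e \<noteq> 0"
    by (simp add: e_def vec_eq_iff)
  define g :: "real^('a^'n^'m)" where
    "g = (\<chi> z. (if p v* z = 0 then 1 else 0) - (if p v* z = e then 1 else 0))"
  have "g $ 0 = 1"
    using e by (simp add: g_def)
  then have g0: "g \<noteq> 0"
    by (metis zero_index zero_neq_one)
  have fixed: "shift_avg u g = g" if "p \<cdot> u = 0" for u
    using that by (simp add: shift_avg_fixed_iff g_def vector_matrix_mult_add_rdistrib)
  have killed: "shift_avg u g = 0" if "p \<cdot> u \<noteq> 0" for u
  proof -
    have one: "(\<Sum>v\<in>UNIV. if p v* z + (p \<cdot> u) *s v = d then 1 else 0 :: real) = 1" for z d
    proof -
      have "p v* z + (p \<cdot> u) *s v = d \<longleftrightarrow> v = inverse (p \<cdot> u) *s (d - p v* z)" for v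
        using that by (auto simp: vec_eq_iff field_simps)
      then show ?thesis
        by simp
    qed
    have "shift_avg u g $ z = 0" for z
      by (simp add: shift_avg_nth g_def vector_matrix_mult_add_rdistrib sum_subtractf one)
    then show ?thesis
      by (simp add: vec_eq_iff)
  qed
  have "stabilizer g = {u. p \<cdot> u = 0}"
    using fixed killed g0 by (force simp: stabilizer_def)
  moreover have "joint_eigenvector g"
    unfolding joint_eigenvector_def using fixed killed by blast
  ultimately show thesis
    using g0 that by blast
qed

lemma second_largest_eigenvalue_bilinear_matrix:
  "second_largest_eigenvalue (bilinear_matrix :: real^('a::{field,finite}^'n^'m)^('a^'n^'m)) =
    bilinear_eigenvalue TYPE('a) TYPE('n) TYPE('m) (real CARD('a) ^ CARD('m) / real CARD('a))"
proof -
  define S where "S = eigenvalues (bilinear_matrix :: real^('a^'n^'m)^('a^'n^'m))"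
  let ?\<theta> = "bilinear_eigenvalue TYPE('a) TYPE('n) TYPE('m)"
  let ?c = "real CARD('a) ^ CARD('m)"
  have lt: "?c / real CARD('a) < ?c"
    using field_card_gt_1[where 'a = 'a] by (simp add: field_simps)
  \<comment> \<open>Eigenvalues are indexed by subsets of a finite space; the finiteness gives
    meaning to \<open>Max\<close>.\<close>
  have "S \<subseteq> (\<lambda>T :: ('a^'m) set. ?\<theta> (real (card T))) ` UNIV"
  proof
    fix \<mu> assume "\<mu> \<in> S"
    then obtain g :: "real^('a^'n^'m)" where "\<mu> = ?\<theta> (real (card (stabilizer g)))"
      using eigenvalue_obtains_stabilizer unfolding S_def by metis
    then show "\<mu> \<in> (\<lambda>T :: ('a^'m) set. ?\<theta> (real (card T))) ` UNIV"
      by blast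
  qed
  then have fin: "finite S"
    using finite_surj[of "UNIV :: ('a^'m) set set"] by simp
  have bound: "\<mu> = ?\<theta> ?c \<or> \<mu> \<le> ?\<theta> (?c / real CARD('a))" if \<mu>: "\<mu> \<in> S" for \<mu>
  proof -
    obtain g :: "real^('a^'n^'m)" where g: "\<mu> = ?\<theta> (real (card (stabilizer g)))"
      using \<mu> eigenvalue_obtains_stabilizer unfolding S_def by metis
    show ?thesis
    proof (cases "stabilizer g = UNIV")
      case True
      then show ?thesis
        using g by simp
    next
      case False
      then show ?thesis
        using card_proper_subspace_le(1)[OF subspace_stabilizer] g
        by (auto simp: bilinear_eigenvalue_le_iff)
    qed
  qed
  have top: "?\<theta> ?c \<in> S"
  proof -
    define g :: "real^('a^'n^'m)" where "g = (\<chi> z. 1)"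
    have fixed: "shift_avg u g = g" for u
      by (simp add: shift_avg_fixed_iff g_def)
    then have "stabilizer g = UNIV" "joint_eigenvector g"
      by (simp_all add: stabilizer_def joint_eigenvector_def)
    moreover have "g \<noteq> 0"
      by (simp add: g_def vec_eq_iff)
    ultimately show ?thesis
      using joint_eigenvector_in_eigenvalues[of g] by (simp add: S_def)
  qed
  have second: "?\<theta> (?c / real CARD('a)) \<in> S"
  proof -
    define p :: "'a^'m" where "p = (\<chi> i. 1)"
    have p: "p \<noteq> 0"
      by (simp add: p_def vec_eq_iff)
    then obtain g :: "real^('a^'n^'m)" where
      g: "g \<noteq> 0" "joint_eigenvector g" "stabilizer g = {u. p \<cdot> u = 0}"
      by (rule ex_joint_eigenvector_hyperplane)
    have "CARD('a) * card (stabilizer g) = CARD('a) ^ CARD('m)"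
      unfolding g(3) using card_dotp_fibre(2)[OF p] .
    then have "real CARD('a) * real (card (stabilizer g)) = ?c"
      by (metis of_nat_mult of_nat_power)
    then have "real (card (stabilizer g)) = ?c / real CARD('a)"
      by (simp add: field_simps)
    then show ?thesis
      using joint_eigenvector_in_eigenvalues[OF g(2,1)] by (simp add: S_def)
  qed
  have "?\<theta> (?c / real CARD('a)) \<le> ?\<theta> ?c" "?\<theta> (?c / real CARD('a)) \<noteq> ?\<theta> ?c"
    using lt by (simp_all add: bilinear_eigenvalue_le_iff bilinear_eigenvalue_eq_iff)
  then have "Max S = ?\<theta> ?c"
    using fin top bound by (intro Max_eqI) fastforce+
  moreover have "Max (S - {?\<theta> ?c}) = ?\<theta> (?c / real CARD('a))"
    using fin second bound \<open>?\<theta> (?c / real CARD('a)) \<noteq> ?\<theta> ?c\<close> by (intro Max_eqI) auto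
  ultimately show ?thesis
    unfolding second_largest_eigenvalue_def S_def[symmetric] by simp
qed

text \<open>The difference \<open>z' - z\<close> is annihilated by \<open>p\<close>, so each of its
  columns is in the stabilizer. Shifting by one column at a time leads from \<open>z\<close> to
  \<open>z'\<close>.\<close>

lemma eq_if_stabilizer_hyperplane:
  assumes g: "stabilizer g = {u. p \<cdot> u = 0}" and z: "p v* z = p v* z'"
  shows "g $ z = g $ z'"
proof -
  have col: "p \<cdot> column j (z' - z) = 0" for j
  proof -
    have "p \<cdot> column j (z' - z) = (p v* (z' - z)) $ j"
      by (simp add: scalar_product_def column_def vector_matrix_mult_def)
    then show ?thesis
      using z by (simp add: vector_matrix_mult_diff_rdistrib)
  qed
  have "g $ (z + (\<Sum>j\<in>F. outer (column j (z' - z)) (axis j 1))) = g $ z" for F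
  proof (induction F rule: infinite_finite_induct)
    case (insert j F)
    have "column j (z' - z) \<in> stabilizer g"
      using g col by simp
    then have "g $ (y + outer (column j (z' - z)) v) = g $ y" for y v
      by (simp add: stabilizer_def shift_avg_fixed_iff)
    then show ?case
      using insert by (simp add: add.commute[of "outer _ _"] flip: add.assoc)
  qed simp_all
  moreover have "(\<Sum>j\<in>UNIV. outer (column j (z' - z)) (axis j 1)) = z' - z"
    by (simp add: vec_eq_iff column_def axis_def if_distrib if_distribR cong: if_cong)
  ultimately have "g $ (z + (z' - z)) = g $ z"
    by metis
  then show ?thesis
    by simp
qed

text \<open>Shifts permute the fibres of each \<open>p\<close>, so the functions with vanishing
  fibre sums form an invariant space, spanned by its joint eigenvectors. One of these for the second
  largest eigenvalue would be constant on the fibres of some \<open>p\<close>; as its sums there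
  vanish, it would be zero. All others are killed by \<open>E\<close>.\<close>

lemma idempotent_eq_0:
  fixes w :: "real^('a::{field,finite}^'n^'m)"
  assumes E: "is_primitive_idempotent (bilinear_matrix :: real^('a^'n^'m)^('a^'n^'m))
      (second_largest_eigenvalue (bilinear_matrix :: real^('a^'n^'m)^('a^'n^'m))) E"
    and w: "\<And>p c. (\<Sum>z | p v* z = c. w $ z) = 0"
  shows "E *v w = 0"
proof -
  define Q where "Q = {f :: real^('a^'n^'m). \<forall>p c. (\<Sum>z | p v* z = c. f $ z) = 0}"
  have "subspace Q"
    by (auto simp: subspace_def Q_def sum.distrib simp flip: sum_distrib_left)
  moreover have "shift_avg u f \<in> Q" if f: "f \<in> Q" for u f
  proof -
    have "(\<Sum>z | p v* z = c. f $ (z + outer u v)) = 0" for p c v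
    proof -
      have "(\<Sum>z | p v* z = c. f $ (z + outer u v)) = (\<Sum>z | p v* z = c + (p \<cdot> u) *s v. f $ z)"
        by (rule sum.reindex_bij_witness[of _ "\<lambda>z. z - outer u v" "\<lambda>z. z + outer u v"])
          (auto simp: vector_matrix_mult_add_rdistrib vector_matrix_mult_diff_rdistrib)
      then show ?thesis
        using f by (simp add: Q_def)
    qed
    then show ?thesis
      unfolding Q_def mem_Collect_eq shift_avg_nth sum_divide_distrib[symmetric]
      by (subst sum.swap) simp
  qed
  moreover have "w \<in> Q"
    using w by (simp add: Q_def)
  ultimately have span: "w \<in> span {g \<in> Q. joint_eigenvector g}"
    by (rule in_span_joint_eigenvector)
  have "E *v g = 0" if g: "g \<in> Q" "joint_eigenvector g" for g
  proof (cases "g = 0")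
    case True
    then show ?thesis
      by simp
  next
    case False
    let ?\<theta> = "bilinear_eigenvalue TYPE('a) TYPE('n) TYPE('m)"
    let ?\<mu> = "?\<theta> (real (card (stabilizer g)))"
    have "g \<in> eigenspace bilinear_matrix ?\<mu>"
      using bilinear_matrix_joint_eigenvector[OF g(2)] by (simp add: eigenspace_def)
    moreover have "?\<mu> \<noteq> second_largest_eigenvalue (bilinear_matrix :: real^('a^'n^'m)^('a^'n^'m))"
    proof
      assume "?\<mu> = second_largest_eigenvalue (bilinear_matrix :: real^('a^'n^'m)^('a^'n^'m))"
      then have c: "real (card (stabilizer g)) = real CARD('a) ^ CARD('m) / real CARD('a)"
        by (simp add: second_largest_eigenvalue_bilinear_matrix bilinear_eigenvalue_eq_iff)
      moreover have "stabilizer g \<noteq> UNIV"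
        using c field_card_gt_1[where 'a = 'a] by (auto simp: field_simps)
      ultimately obtain p where p: "stabilizer g = {u. p \<cdot> u = 0}"
        using card_proper_subspace_le(2)[OF subspace_stabilizer] by blast
      have "g $ z = 0" for z
      proof -
        have "0 = (\<Sum>z' | p v* z' = p v* z. g $ z')"
          using g(1) by (simp add: Q_def)
        also have "\<dots> = (\<Sum>z' | p v* z' = p v* z. g $ z)"
          by (intro sum.cong refl eq_if_stabilizer_hyperplane[OF p]) simp
        also have "\<dots> = real (card {z'. p v* z' = p v* z}) * g $ z"
          by simp
        finally show ?thesis
          by auto
      qed
      then show False
        using False by (simp add: vec_eq_iff)
    qed
    ultimately show ?thesis
      using E joint_eigenvector_in_eigenvalues[OF g(2) False] unfolding is_primitive_idempotent_def by blast
  qed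
  then show ?thesis
    using linear_eq_0_on_span[OF matrix_vector_mul_linear[of E], of "{g \<in> Q. joint_eigenvector g}"] span by blast
qed

text \<open>Differences of \<open>theta_star\<close> at a and b are proportional to q^-a - q^-b, so
  the quotient is (q^-1 - q^-j) / (1 - q^-k). Here \<open>L\<close> stands for q^(D-k), the size of
  the left kernel of y - x, and the subtracted term on the right is q^(D-j).\<close>

lemma theta_star_ratio:
  assumes q: "1 < q" and N: "1 \<le> k" "k \<le> N" "j \<le> N"
    and L: "real q ^ D = L * real q ^ k"
  shows "(theta_star q D N 1 - theta_star q D N j) / (theta_star q D N 0 - theta_star q D N k) *
    (real q ^ D - L) = real q ^ D / real q - L * real q ^ k / real q ^ j"
proof -
  define Q where "Q = real q"
  have Q: "1 < Q" "Q \<noteq> 0"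
    using q by (simp_all add: Q_def)
  have theta: "theta_star q D N a - theta_star q D N b = Q ^ N * (1 / Q ^ a - 1 / Q ^ b) / (Q - 1)"
    if "a \<le> N" "b \<le> N" for a b
    using that Q by (simp add: theta_star_def Q_def power_diff right_diff_distrib flip: diff_divide_distrib)
  have "1 < Q ^ k"
    using Q N(1) by (intro one_less_power) auto
  then have ne: "1 - 1 / Q ^ k \<noteq> 0"
    by simp
  have cancel: "a / b * (c * b) = a * c" if "b \<noteq> 0" for a b c :: real
    using that by simp
  have "(theta_star q D N 1 - theta_star q D N j) / (theta_star q D N 0 - theta_star q D N k) =
      (1 / Q - 1 / Q ^ j) / (1 - 1 / Q ^ k)"
    using theta[of 1 j] theta[of 0 k] N Q by simp
  moreover have "Q ^ D - L = L * Q ^ k * (1 - 1 / Q ^ k)"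
    using L Q by (simp add: Q_def right_diff_distrib)
  ultimately have "(theta_star q D N 1 - theta_star q D N j) / (theta_star q D N 0 - theta_star q D N k) *
      (Q ^ D - L) = (1 / Q - 1 / Q ^ j) * (L * Q ^ k)"
    by (simp only: cancel[OF ne])
  also have "\<dots> = Q ^ D / Q - L * Q ^ k / Q ^ j"
    using L by (simp add: Q_def left_diff_distrib)
  finally show ?thesis
    by (simp add: Q_def)
qed

theorem theorem8p1:
  fixes x y :: "'a::{field,finite}^'n^'m"
    and E :: "real^('a^'n^'m)^('a^'n^'m)"
    and q D N k :: nat
    and lam :: "nat \<Rightarrow> real"
  defines "adj \<equiv> (bilinear_adj :: 'a^'n^'m \<Rightarrow> 'a^'n^'m \<Rightarrow> bool)"
  defines "A \<equiv> adjacency_matrix adj"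
  defines "O1 \<equiv> y_partition adj q D N x y"
  defines "O2 \<equiv> y_partition adj q D N y x"
  assumes "CARD('a) = q" and "q \<noteq> 2"
    and "CARD('m) = D" and "CARD('n) = N - D"
    and "N > 2 * D" and "2 * D \<ge> 6"
    and "is_primitive_idempotent A (second_largest_eigenvalue A) E"
    and "k = graph_dist adj x y" and "2 \<le> k" and "k \<le> D - 1"
    and "\<And>i. i \<in> {2..5} \<Longrightarrow> lam i = real (card (O1 i)) *
           ((theta_star q D N 1 - theta_star q D N k) /
            (theta_star q D N 0 - theta_star q D N k))"
    and "lam 1 = real (card (O1 1)) *
           ((theta_star q D N 1 - theta_star q D N (k - 1)) /
            (theta_star q D N 0 - theta_star q D N k))"
    and "lam 6 = real (card (O1 6)) *
           ((theta_star q D N 1 - theta_star q D N (k + 1)) /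
            (theta_star q D N 0 - theta_star q D N k))"
  shows "\<forall>i\<in>{1..6}. E *v hat_set (O1 i) - E *v hat_set (O2 i)
           = lam i *\<^sub>R (E *v hat x - E *v hat y)"
proof
  fix i :: nat assume i: "i \<in> {1..6}"
  note lam = assms(15-17)
  define M where "M = y - x"
  define L where "L = card (left_kernel M)"
  have k: "k = bilinear_dist x y" "2 \<le> bilinear_dist x y" "k \<le> N" "k + 1 \<le> N"
    using assms by auto
  have E: "is_primitive_idempotent bilinear_matrix
      (second_largest_eigenvalue (bilinear_matrix :: real^('a^'n^'m)^('a^'n^'m))) E"
    using assms by (simp add: bilinear_matrix_def)
  have q: "1 < q"
    using field_card_gt_1[where 'a = 'a] assms by simp
  have L: "real q ^ D = real L * real q ^ k"
  proof -
    have "L * q ^ k = q ^ D"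
      using bilinear_dist(2)[of x y] left_kernel_diff_commute[of x y] assms by (simp add: L_def M_def)
    then show ?thesis
      by (metis of_nat_mult of_nat_power)
  qed
  obtain J where J: "O1 i = (+) x ` sector M J" "i = 1 \<Longrightarrow> J = {1}" "i = 6 \<Longrightarrow> J = {6}"
    "i \<in> {2..5} \<Longrightarrow> J \<subseteq> {2..5}"
    using y_partition_eq_sector[OF k(2) i, of q D N] unfolding O1_def adj_def M_def by metis
  have O2: "O2 i = (-) y ` sector M J"
  proof -
    define \<phi> where "\<phi> z = x + y - z" for z
    have "\<phi> (\<phi> z) = z" for z
      by (simp add: \<phi>_def)
    then have "bij \<phi>"
      by (intro o_bij[of \<phi>]) (auto simp: fun_eq_iff)
    moreover have "bilinear_dist (\<phi> a) (\<phi> b) = bilinear_dist a b" for a b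
      unfolding \<phi>_def by (rule bilinear_dist_isometry)
    ultimately have "y_partition bilinear_adj q D N (\<phi> x) (\<phi> y) i = \<phi> ` O1 i"
      unfolding O1_def adj_def by (rule y_partition_isometry)
    moreover have "\<phi> x = y" "\<phi> y = x"
      by (simp_all add: \<phi>_def)
    ultimately have "O2 i = \<phi> ` (+) x ` sector M J"
      by (simp add: O2_def adj_def J(1))
    also have "\<dots> = (-) y ` sector M J"
      by (simp add: image_image \<phi>_def)
    finally show ?thesis .
  qed
  have card: "card (O1 i) = card (sector M J)"
    by (simp add: J(1) card_image)
  have type: "\<forall>s\<in>sector M J. real (card (left_kernel (M - s))) = m"
    if "\<And>u v. outer_type M u v \<in> J \<Longrightarrow> real (card (left_kernel (M - outer u v))) = m" for m
    using that by (auto simp: sector_def)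
  \<comment> \<open>The index \<open>j\<close> is the distance from y to the vertices of the part: k
    - 1, k + 1 or k. One equation in \<open>j\<close> then covers the three forms of the
    coefficient.\<close>
  have "\<exists>j\<le>N. (\<forall>s\<in>sector M J. real (card (left_kernel (M - s))) = real L * real q ^ k / real q ^ j) \<and>
      lam i = real (card (O1 i)) * ((theta_star q D N 1 - theta_star q D N j) /
        (theta_star q D N 0 - theta_star q D N k))"
  proof -
    consider "i = 1" | "i = 6" | "i \<in> {2..5}"
      using i by fastforce
    then show ?thesis
    proof cases
      case 1
      have "k = Suc (k - 1)"
        using assms by simp
      then have "real q ^ k = real q * real q ^ (k - 1)"
        by (metis power_Suc)
      then have "real (q * L) = real L * real q ^ k / real q ^ (k - 1)"
        using q by simp
      then have "\<forall>s\<in>sector M J. real (card (left_kernel (M - s))) = real L * real q ^ k / real q ^ (k - 1)"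
        using card_left_kernel_minus_outer_type(1)[of M] J(2)[OF 1] assms(5)
        by (intro type) (simp add: L_def)
      then show ?thesis
        using k lam(2) 1 by (intro exI[of _ "k - 1"]) simp
    next
      case 2
      have "real (card (left_kernel (M - outer u v))) = real L * real q ^ k / real q ^ (k + 1)"
        if "outer_type M u v = 6" for u v
      proof -
        have "real q * real (card (left_kernel (M - outer u v))) = real L"
          using card_left_kernel_minus_outer_type(2)[OF that] assms(5) unfolding L_def by (metis of_nat_mult)
        then show ?thesis
          using q by (simp add: field_simps)
      qed
      then have "\<forall>s\<in>sector M J. real (card (left_kernel (M - s))) = real L * real q ^ k / real q ^ (k + 1)"
        using J(3)[OF 2] by (intro type) simp
      then show ?thesis
        using k lam(3) 2 by (intro exI[of _ "k + 1"]) simp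
    next
      case 3
      have "\<forall>s\<in>sector M J. real (card (left_kernel (M - s))) = real L * real q ^ k / real q ^ k"
        using card_left_kernel_minus_outer_type(3)[of M] J(4)[OF 3] q
        by (intro type) (auto simp: L_def)
      then show ?thesis
        using k lam(1)[OF 3] by (intro exI[of _ k]) simp
    qed
  qed
  then obtain j where j: "j \<le> N"
    "\<And>s. s \<in> sector M J \<Longrightarrow> real (card (left_kernel (M - s))) = real L * real q ^ k / real q ^ j"
    "lam i = real (card (sector M J)) * ((theta_star q D N 1 - theta_star q D N j) /
        (theta_star q D N 0 - theta_star q D N k))"
    unfolding card by blast
  have "lam i * (real q ^ D - real L) =
      real (card (sector M J)) * (real q ^ D / real q - real L * real q ^ k / real q ^ j)"
    unfolding j(3) mult.assoc using theta_star_ratio[OF q _ k(3) j(1) L] k by simp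
  moreover have "x \<noteq> y"
  proof
    assume "x = y"
    then have "graph_dist bilinear_adj x y = 0"
      by (simp add: graph_dist_def Least_eq_0)
    then show False
      using k by simp
  qed
  ultimately have "E *v (hat_set (O1 i) - hat_set (O2 i) - lam i *\<^sub>R (hat x - hat y)) = 0"
    unfolding J(1) O2
    using sum_fibre_eq_0[of x y J "real L * real q ^ k / real q ^ j" "lam i"] j(2) assms(5,7)
    by (intro idempotent_eq_0[OF E]) (simp add: M_def L_def)
  then show "E *v hat_set (O1 i) - E *v hat_set (O2 i) = lam i *\<^sub>R (E *v hat x - E *v hat y)"
    by (simp add: matrix_vector_mult_diff_distrib matrix_vector_mult_scaleR)
qed

end
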